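(* Let $V,H$ be separable Hilbert spaces with $V$ continuously and densely embedded into $H$, let $T>0$, and let $a:[0,T]\times V\times V\to\mathbb{C}$ be such that each $a(t,\cdot,\cdot)$ is a sesquilinear form and: (H1) $a(\cdot,u,v)$ is strongly measurable for all $u,v\in V$; (H2) there is $M>0$ with $|a(t,u,v)|\le M\|u\|_V\|v\|_V$ for all $t\in[0,T]$, $u,v\in V$; (H3) there is $\alpha>0$ with $\mathrm{Re}\,a(t,u,u)\ge\alpha\|u\|_V^2$ for all $t\in[0,T]$, $u\in V$; (H4) $|a(t,u,v)-a(s,u,v)|\le\omega(|t-s|)\|u\|_V\|v\|_V$ for all $t,s\in[0,T]$ and $u,v\in V$, for some nondecreasing $\omega:[0,T]\to[0,+\infty)$ with $\int_0^T\omega(t)t^{-3/2}\,dt<\infty$ and $\int_0^T(\omega(t)/t)^2\,dt<\infty$; (S) $\mathcal{D}(A(t)^{1/2})=V$ for every $t\in[0,T]$, where $A(t)$ is the operator on $H$ associated with $a(t,\cdot,\cdot)$. Let $\{\varphi_n\}_{n\in\mathbb{N}}$ be a Schauder basis of $V$ and of $H$, orthogonal with respect to $\langle\cdot,\cdot\rangle_H$, let $\mathbb{P}_m\big(\sum_{j=1}^\infty v_j\varphi_j\big):=\sum_{j=1}^m v_j\varphi_j$, and let $A_m(t)$ be the operator on $H$ associated with the form $$a_m(t,u,v):=a(t,\mathbb{P}_mu,\mathbb{P}_mv)+\alpha\langle(I-\mathbb{P}_m)u,(I-\mathbb{P}_m)v\rangle_V\qquad(u,v\in V).$$ Let $\{E(t,s)\}_{0\le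 s<t\le T}$ and $\{E_m(t,s)\}_{0\le s<t\le T}$ be the evolution systems generated by $A(t)$ and $A_m(t)$ respectively. Then for every $x\in H$ and every $s\in[0,T)$, $$E_m(t,s)\mathbb{P}_mx\to E(t,s)x\ \text{ in } H \text{ as } m\to\infty,\ \text{ uniformly in } t\in(s,T].$$
   Context: The operator on $H$ associated with a form $b(\cdot,\cdot)$ on $V$ is the operator $B$ with domain those $u\in V$ for which there is $h\in H$ with $b(u,v)=\langle h,v\rangle_H$ for all $v\in V$, and $Bu:=h$. The evolution system $\{E(t,s)\}_{0\le s<t\le T}\subset\mathcal{L}(H)$ generated by $A(t)$ is the contractive, strongly continuous evolution family (with $E(t,r)E(r,s)=E(t,s)$ for $s<r<t$) on $H$ such that for $x\in V$ the function $u(t)=E(t,s)x$ is the unique solution in $H^1([s,T],H)\cap L^2([s,T],V)$ of $u'(t)+A(t)u(t)=0$ for a.e. $t\in[s,T]$, $u(s)=x$; for $x\in H$ it is obtained by continuous extension, using density of $V$ in $H$. The evolution system $\{E_m(t,s)\}$ is defined in the same way from $A_m(t)$. Such families exist under the stated hypotheses. *)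

theory Defs
  imports "HOL-Analysis.Analysis"
begin

text \<open>
  Complex inner product spaces. The real inner product inherited from \<open>real_inner\<close> is the real
  part of the complex one, so norm, metric and topology are those of the complex inner product.
  As is customary for form methods, \<open>cinner\<close> is linear in its first and conjugate linear in its
  second argument.
\<close>

class complex_inner = real_inner +
  fixes scaleC :: "complex \<Rightarrow> 'a \<Rightarrow> 'a" (infixr "*\<^sub>C" 75)
    and cinner :: "'a \<Rightarrow> 'a \<Rightarrow> complex"
  assumes scaleC_add_right: "c *\<^sub>C (x + y) = c *\<^sub>C x + c *\<^sub>C y"
    and scaleC_add_left: "(c + d) *\<^sub>C x = c *\<^sub>C x + d *\<^sub>C x"
    and scaleC_scaleC: "c *\<^sub>C (d *\<^sub>C x) = (c * d) *\<^sub>C x"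
    and scaleC_of_real: "complex_of_real r *\<^sub>C x = r *\<^sub>R x"
    and cinner_commute: "cinner x y = cnj (cinner y x)"
    and cinner_add_left: "cinner (x + y) z = cinner x z + cinner y z"
    and cinner_scaleC_left: "cinner (c *\<^sub>C x) y = c * cinner x y"
    and Re_cinner: "Re (cinner x y) = inner x y"

class complex_hilbert_space = complex_inner + banach

definition bounded_clinear :: "('a::complex_inner \<Rightarrow> 'b::complex_inner) \<Rightarrow> bool" where
  "bounded_clinear f \<longleftrightarrow> bounded_linear f \<and> (\<forall>c x. f (c *\<^sub>C x) = c *\<^sub>C f x)"

definition sesquilinear :: "('a::complex_inner \<Rightarrow> 'a \<Rightarrow> complex) \<Rightarrow> bool" where
  "sesquilinear b \<longleftrightarrow>
     (\<forall>u u' v. b (u + u') v = b u v + b u' v) \<and>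
     (\<forall>u v v'. b u (v + v') = b u v + b u v') \<and>
     (\<forall>c u v. b (c *\<^sub>C u) v = c * b u v) \<and>
     (\<forall>c u v. b u (c *\<^sub>C v) = cnj c * b u v)"

text \<open>
  The inclusion of \<open>V\<close> into \<open>H\<close> is an explicit map \<open>\<iota>\<close>, so that the subset \<open>V\<close> of \<open>H\<close> is \<open>range \<iota>\<close>.
\<close>

definition dense_embedding :: "('v::complex_inner \<Rightarrow> 'h::complex_inner) \<Rightarrow> bool" where
  "dense_embedding \<iota> \<longleftrightarrow> bounded_clinear \<iota> \<and> inj \<iota> \<and> closure (range \<iota>) = UNIV"

text \<open>Unbounded operators on \<open>H\<close> are represented by their graphs; the domain is \<^const>\<open>Domain\<close>.\<close>

definition assoc_op ::
    "('v \<Rightarrow> 'h::complex_inner) \<Rightarrow> ('v \<Rightarrow> 'v \<Rightarrow> complex) \<Rightarrow> ('h \<times> 'h) set" where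
  "assoc_op \<iota> b = {(\<iota> u, h) |u h. \<forall>v. b u v = cinner h (\<iota> v)}"

text \<open>\<open>resolvent A r f\<close> is \<open>(r + A)\<inverse> f\<close>.\<close>

definition resolvent :: "('h \<times> 'h) set \<Rightarrow> real \<Rightarrow> 'h \<Rightarrow> 'h::complex_inner" where
  "resolvent A r f = (THE u. \<exists>h. (u, h) \<in> A \<and> r *\<^sub>R u + h = f)"

text \<open>
  The square root of an operator with \<open>norm ((r + A)\<inverse>) \<le> C / (1 + r)\<close> for \<open>r \<ge> 0\<close> (in particular
  of the operator associated with a bounded coercive form) is defined as the inverse of
  \<open>A\<^sup>-\<^sup>1\<^sup>/\<^sup>2 = 1/\<pi> \<integral>\<^sub>0\<^sup>\<infinity> r\<^sup>-\<^sup>1\<^sup>/\<^sup>2 (r + A)\<inverse> dr\<close>.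
\<close>

definition inv_sqrt_op ::
    "('h \<times> 'h) set \<Rightarrow> 'h \<Rightarrow> 'h::{complex_hilbert_space, second_countable_topology}" where
  "inv_sqrt_op A x =
     (1 / pi) *\<^sub>R (LINT r:{0<..}|lborel. (r powr (-1/2)) *\<^sub>R resolvent A r x)"

definition sqrt_op ::
    "('h \<times> 'h) set \<Rightarrow> ('h \<times> 'h::{complex_hilbert_space, second_countable_topology}) set" where
  "sqrt_op A = {(inv_sqrt_op A y, y) |y. True}"

definition schauder_basis :: "(nat \<Rightarrow> 'a::complex_inner) \<Rightarrow> bool" where
  "schauder_basis e \<longleftrightarrow> (\<forall>x. \<exists>!c. (\<lambda>j. c j *\<^sub>C e j) sums x)"

definition basis_coeff :: "(nat \<Rightarrow> 'a::complex_inner) \<Rightarrow> 'a \<Rightarrow> nat \<Rightarrow> complex" where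
  "basis_coeff e x = (THE c. (\<lambda>j. c j *\<^sub>C e j) sums x)"

text \<open>Basis vectors are numbered from \<open>0\<close>, so the first \<open>m\<close> of them are those with \<open>j < m\<close>.\<close>

definition basis_proj :: "(nat \<Rightarrow> 'a::complex_inner) \<Rightarrow> nat \<Rightarrow> 'a \<Rightarrow> 'a" where
  "basis_proj e m x = (\<Sum>j<m. basis_coeff e x j *\<^sub>C e j)"

definition approx_form ::
    "(real \<Rightarrow> 'v \<Rightarrow> 'v \<Rightarrow> complex) \<Rightarrow> real \<Rightarrow> (nat \<Rightarrow> 'v::complex_inner) \<Rightarrow> nat \<Rightarrow>
     real \<Rightarrow> 'v \<Rightarrow> 'v \<Rightarrow> complex" where
  "approx_form a \<alpha> \<phi> m t u v =
     a t (basis_proj \<phi> m u) (basis_proj \<phi> m v)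
     + complex_of_real \<alpha> * cinner (u - basis_proj \<phi> m u) (v - basis_proj \<phi> m v)"

definition L2_on ::
    "real \<Rightarrow> real \<Rightarrow> (real \<Rightarrow> 'a::{real_normed_vector, second_countable_topology}) \<Rightarrow> bool" where
  "L2_on s T f \<longleftrightarrow>
     f \<in> borel_measurable (lebesgue_on {s..T}) \<and>
     integrable (lebesgue_on {s..T}) (\<lambda>t. (norm (f t))\<^sup>2)"

text \<open>Test functions are the real functions of class \<open>C\<^sup>1\<close> with compact support in the open interval.\<close>

definition weak_derivative_on ::
    "real \<Rightarrow> real \<Rightarrow> (real \<Rightarrow> 'a::{banach, second_countable_topology}) \<Rightarrow> (real \<Rightarrow> 'a) \<Rightarrow> bool" where
  "weak_derivative_on s T u g \<longleftrightarrow>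
     (\<forall>\<psi> \<psi>' :: real \<Rightarrow> real.
        (\<forall>t. (\<psi> has_real_derivative \<psi>' t) (at t)) \<and> continuous_on UNIV \<psi>' \<and>
        (\<exists>c d. s < c \<and> d < T \<and> (\<forall>t. t \<notin> {c..d} \<longrightarrow> \<psi> t = 0)) \<longrightarrow>
        (LINT t|lebesgue_on {s..T}. \<psi>' t *\<^sub>R u t) = - (LINT t|lebesgue_on {s..T}. \<psi> t *\<^sub>R g t))"

text \<open>
  \<open>u\<close> belongs to \<open>H\<^sup>1([s,T],H) \<inter> L\<^sup>2([s,T],V)\<close>, with weak derivative \<open>g\<close>, and solves
  \<open>u' + A(t) u = 0\<close>, \<open>u(s) = x\<close>. Elements of \<open>H\<^sup>1([s,T],H)\<close> are represented by their continuous
  representatives; this gives the initial condition its meaning and makes uniqueness pointwise.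
\<close>

definition solves_cauchy ::
    "('v::{complex_hilbert_space, second_countable_topology} \<Rightarrow>
        'h::{complex_hilbert_space, second_countable_topology}) \<Rightarrow>
     (real \<Rightarrow> ('h \<times> 'h) set) \<Rightarrow> real \<Rightarrow> real \<Rightarrow> 'h \<Rightarrow> (real \<Rightarrow> 'h) \<Rightarrow> bool" where
  "solves_cauchy \<iota> A s T x u \<longleftrightarrow>
     continuous_on {s..T} u \<and> L2_on s T u \<and>
     (\<exists>w. L2_on s T w \<and> (AE t in lebesgue_on {s..T}. \<iota> (w t) = u t)) \<and>
     (\<exists>g. L2_on s T g \<and> weak_derivative_on s T u g \<and>
          (AE t in lebesgue_on {s..T}. (u t, - g t) \<in> A t)) \<and>
     u s = x"

text \<open>
  Only the values \<open>E t s\<close> with \<open>0 \<le> s < t \<le> T\<close> matter. Strong continuity and the initial value are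
  expressed through the extension by the identity to \<open>s = t\<close>.
\<close>

definition evol_ext :: "(real \<Rightarrow> real \<Rightarrow> 'h \<Rightarrow> 'h) \<Rightarrow> real \<Rightarrow> real \<Rightarrow> 'h \<Rightarrow> 'h" where
  "evol_ext E t s x = (if s < t then E t s x else x)"

definition evolution_system ::
    "('v::{complex_hilbert_space, second_countable_topology} \<Rightarrow>
        'h::{complex_hilbert_space, second_countable_topology}) \<Rightarrow>
     real \<Rightarrow> (real \<Rightarrow> ('h \<times> 'h) set) \<Rightarrow> (real \<Rightarrow> real \<Rightarrow> 'h \<Rightarrow> 'h) \<Rightarrow> bool" where
  "evolution_system \<iota> T A E \<longleftrightarrow>
     (\<forall>s t. 0 \<le> s \<and> s < t \<and> t \<le> T \<longrightarrow> bounded_clinear (E t s) \<and> (\<forall>x. norm (E t s x) \<le> norm x)) \<and>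
     (\<forall>s r t x. 0 \<le> s \<and> s < r \<and> r < t \<and> t \<le> T \<longrightarrow> E t r (E r s x) = E t s x) \<and>
     (\<forall>x. continuous_on {(t, s). 0 \<le> s \<and> s \<le> t \<and> t \<le> T} (\<lambda>(t, s). evol_ext E t s x)) \<and>
     (\<forall>s x. 0 \<le> s \<and> s < T \<longrightarrow>
        solves_cauchy \<iota> A s T (\<iota> x) (\<lambda>t. evol_ext E t s (\<iota> x)) \<and>
        (\<forall>u. solves_cauchy \<iota> A s T (\<iota> x) u \<longrightarrow> (\<forall>t\<in>{s..T}. u t = evol_ext E t s (\<iota> x))))"

end

theory Submission
  imports Defs
begin

text \<open>
  For \<open>x\<close> in \<open>V\<close> let \<open>u\<close> and \<open>u\<^sub>m\<close> be the two solutions, \<open>e = u\<^sub>m - u\<close>, and let \<open>P\<close> be the projection onto the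
  first \<open>m\<close> basis vectors; by orthogonality it is the orthogonal projection in \<open>H\<close>. Testing both
  equations with \<open>e\<close>, the coercivity of \<open>a\<^sub>m\<close> controls \<open>P e\<close> and \<open>e - P e\<close> in \<open>V\<close>. In the consistency error
  \<open>a(u, e) - a\<^sub>m(u, e)\<close> the only term that is not small through \<open>u - P u\<close> is
  \<open>a(u, e - P e) = -\<langle>u' - P u', e\<rangle>\<close>, so that almost everywhere
  \<open>d/dt \<parallel>e\<parallel>\<^sup>2 \<le> C (\<parallel>u - P u\<parallel>\<^sup>2 + \<parallel>u' - P u'\<parallel>\<^sup>2)\<close> with the norms of \<open>V\<close> and of \<open>H\<close>. As \<open>u\<close> is in \<open>L\<^sup>2([s,T],V)\<close>, \<open>u'\<close> is in
  \<open>L\<^sup>2([s,T],H)\<close> and the projections are uniformly bounded in \<open>V\<close> (Banach-Steinhaus), the integral of the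
  right-hand side tends to \<open>0\<close> by dominated convergence. Density of \<open>V\<close> and contractivity of the
  evolution systems extend the convergence to \<open>x\<close> in \<open>H\<close>.
\<close>

subsection \<open>Complex inner products and orthogonal bases\<close>

lemma cinner_add_right: "cinner x (y + z) = cinner x y + cinner x z"
  by (metis cinner_commute cinner_add_left complex_cnj_add)

lemma cinner_scaleC_right: "cinner x (c *\<^sub>C y) = cnj c * cinner x y"
  by (metis cinner_commute cinner_scaleC_left complex_cnj_mult)

lemma cinner_zero_left [simp]: "cinner 0 y = 0"
  using cinner_add_left[of 0 0 y] by simp

lemma cinner_minus_left: "cinner (- x) y = - cinner x y"
  using cinner_add_left[of x "- x" y] by (simp add: eq_neg_iff_add_eq_0 add.commute)

lemma cinner_diff_left: "cinner (x - y) z = cinner x z - cinner y z"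
  using cinner_add_left[of "x - y" y z] by simp

lemma cinner_diff_right: "cinner x (y - z) = cinner x y - cinner x z"
  using cinner_add_right[of x "y - z" z] by simp

lemma cinner_sum_left: "cinner (sum f A) y = (\<Sum>i\<in>A. cinner (f i) y)"
  by (induction A rule: infinite_finite_induct) (simp_all add: cinner_add_left)

lemma cinner_self: "cinner x x = complex_of_real ((norm x)\<^sup>2)"
proof (rule complex_eqI)
  have "Im (cinner x x) = - Im (cinner x x)"
    by (subst (1) cinner_commute) simp
  then show "Im (cinner x x) = Im (complex_of_real ((norm x)\<^sup>2))" by simp
qed (simp add: Re_cinner power2_norm_eq_inner)

text \<open>The class ties the norm to real scalars only; complex ones are covered by
  sesquilinearity of \<open>cinner\<close>, since \<open>cinner x x\<close> is the squared
  norm.\<close>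

lemma norm_scaleC: "norm (c *\<^sub>C x) = norm c * norm x"
proof -
  have "complex_of_real ((norm (c *\<^sub>C x))\<^sup>2) = c * cnj c * cinner x x"
    by (simp only: cinner_self[symmetric] cinner_scaleC_left cinner_scaleC_right ac_simps)
  also have "\<dots> = complex_of_real ((norm c * norm x)\<^sup>2)"
    by (simp add: cinner_self complex_norm_square[symmetric] power_mult_distrib)
  finally have "(norm (c *\<^sub>C x))\<^sup>2 = (norm c * norm x)\<^sup>2"
    using of_real_eq_iff by blast
  then show ?thesis
    by (simp add: power2_eq_iff_nonneg)
qed

text \<open>Real and imaginary part are bounded separately by the real Cauchy-Schwarz inequality,
  the imaginary part being minus the real part for \<open>\<i> *\<^sub>C x\<close>. Hence the factor
  2, harmless for continuity.\<close>

lemma norm_cinner_le: "norm (cinner x y) \<le> 2 * norm x * norm y"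
proof -
  have "Im (cinner x y) = - inner (\<i> *\<^sub>C x) y"
    by (simp add: Re_cinner[symmetric] cinner_scaleC_left)
  then have "\<bar>Im (cinner x y)\<bar> \<le> norm x * norm y"
    using Cauchy_Schwarz_ineq2[of "\<i> *\<^sub>C x" y] by (simp add: norm_scaleC)
  moreover have "\<bar>Re (cinner x y)\<bar> \<le> norm x * norm y"
    by (simp add: Re_cinner Cauchy_Schwarz_ineq2)
  ultimately show ?thesis
    using cmod_le[of "cinner x y"] by simp
qed

lemma bounded_linear_cinner_left: "bounded_linear (\<lambda>x. cinner x y)"
proof (rule bounded_linear_intro[where K = "2 * norm y"])
  show "cinner (r *\<^sub>R x) y = r *\<^sub>R cinner x y" for r x
    by (simp add: scaleC_of_real[symmetric] cinner_scaleC_left scaleR_conv_of_real)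
  show "norm (cinner x y) \<le> norm x * (2 * norm y)" for x
    using norm_cinner_le[of x y] by (simp add: mult_ac)
qed (rule cinner_add_left)

lemma bounded_linear_scaleC_left: "bounded_linear (\<lambda>c. c *\<^sub>C x)"
proof (rule bounded_linear_intro[where K = "norm x"])
  show "(r *\<^sub>R c) *\<^sub>C x = r *\<^sub>R c *\<^sub>C x" for r c
    by (simp add: scaleC_of_real[symmetric] scaleC_scaleC scaleR_conv_of_real)
qed (simp_all add: scaleC_add_left norm_scaleC)

section \<open>Schauder bases and orthogonal projections\<close>

lemma schauder_basis_sums:
  assumes "schauder_basis e"
  shows "(\<lambda>j. basis_coeff e x j *\<^sub>C e j) sums x"
  using assms theI'[of "\<lambda>c. (\<lambda>j. c j *\<^sub>C e j) sums x"]
  by (auto simp: schauder_basis_def basis_coeff_def)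

lemma basis_proj_tendsto:
  assumes "schauder_basis e"
  shows "(\<lambda>m. basis_proj e m x) \<longlonglongrightarrow> x"
  using schauder_basis_sums[OF assms, of x] by (simp add: basis_proj_def sums_def)

text \<open>If \<open>e k\<close> were 0, the coefficient at \<open>k\<close> in an expansion of 0
  could be chosen freely, against uniqueness.\<close>

lemma schauder_basis_nonzero:
  fixes e :: "nat \<Rightarrow> 'a::complex_inner"
  assumes "schauder_basis e"
  shows "e k \<noteq> 0"
proof
  assume z: "e k = 0"
  have s0: "c *\<^sub>C (0::'a) = 0" for c
    using norm_scaleC[of c "0::'a"] by simp
  have t0: "(0::complex) *\<^sub>C x = 0" for x :: 'a
    using norm_scaleC[of 0 x] by simp
  have "(\<lambda>j. ((\<lambda>_. 0)(k := c)) j *\<^sub>C e j) = (\<lambda>_. 0)" for c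
    by (auto simp: z s0 t0)
  then have "(\<lambda>j. ((\<lambda>_. 0)(k := c)) j *\<^sub>C e j) sums 0" for c
    by simp
  then have "(\<lambda>_. 0)(k := 1) = (\<lambda>_. 0::complex)(k := 0)"
    using assms unfolding schauder_basis_def by blast
  from fun_cong[OF this, of k] show False by simp
qed

text \<open>By continuity the series may be paired with \<open>e k\<close> term by term, and
  orthogonality leaves a single term.\<close>

lemma orthogonal_coeff:
  assumes orth: "\<And>i j. i \<noteq> j \<Longrightarrow> cinner (e i) (e j) = 0"
    and sums: "(\<lambda>j. c j *\<^sub>C e j) sums x" and nz: "e k \<noteq> 0"
  shows "c k = cinner x (e k) / cinner (e k) (e k)"
proof -
  have "(\<lambda>j. cinner (c j *\<^sub>C e j) (e k)) sums cinner x (e k)"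
    by (rule bounded_linear.sums[OF bounded_linear_cinner_left sums])
  moreover have "(\<lambda>j. cinner (c j *\<^sub>C e j) (e k)) = (\<lambda>j. if j = k then c k * cinner (e k) (e k) else 0)"
    by (auto simp: cinner_scaleC_left orth)
  ultimately have "cinner x (e k) = c k * cinner (e k) (e k)"
    using sums_single[of k "\<lambda>_. c k * cinner (e k) (e k)"] sums_unique2 by fastforce
  with nz show ?thesis by (simp add: cinner_self)
qed

lemma bounded_clinear_sum:
  assumes "bounded_clinear f"
  shows "f (\<Sum>j\<in>A. c j *\<^sub>C x j) = (\<Sum>j\<in>A. c j *\<^sub>C f (x j))"
  using assms by (simp add: bounded_clinear_def linear_sum bounded_linear.linear)

text \<open>The embedding maps the expansion of \<open>v\<close> in \<open>V\<close> to an expansion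
  of \<open>\<iota> v\<close> in \<open>H\<close> with the same coefficients. So the coefficients in
  \<open>V\<close> are given by inner products of \<open>H\<close>, which links the two
  projections.\<close>

lemma basis_coeff_embedding:
  assumes \<iota>: "bounded_clinear \<iota>"
    and \<phi>: "schauder_basis \<phi>" and e: "schauder_basis (\<lambda>n. \<iota> (\<phi> n))"
    and orth: "\<And>i j. i \<noteq> j \<Longrightarrow> cinner (\<iota> (\<phi> i)) (\<iota> (\<phi> j)) = 0"
  shows "basis_coeff \<phi> v k = cinner (\<iota> v) (\<iota> (\<phi> k)) / cinner (\<iota> (\<phi> k)) (\<iota> (\<phi> k))"
proof (rule orthogonal_coeff[OF orth _ schauder_basis_nonzero[OF e]])
  show "(\<lambda>j. basis_coeff \<phi> v j *\<^sub>C \<iota> (\<phi> j)) sums \<iota> v"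
    using \<iota> bounded_linear.sums[OF _ schauder_basis_sums[OF \<phi>, of v], of \<iota>]
    by (simp add: bounded_clinear_def)
qed

lemma basis_coeff_orthogonal:
  assumes "schauder_basis e" and "\<And>i j. i \<noteq> j \<Longrightarrow> cinner (e i) (e j) = 0"
  shows "basis_coeff e x k = cinner x (e k) / cinner (e k) (e k)"
  using orthogonal_coeff[OF assms(2) schauder_basis_sums[OF assms(1)]
      schauder_basis_nonzero[OF assms(1)]] .

lemma basis_proj_embedding:
  assumes "bounded_clinear \<iota>"
    and "schauder_basis \<phi>" and "schauder_basis (\<lambda>n. \<iota> (\<phi> n))"
    and "\<And>i j. i \<noteq> j \<Longrightarrow> cinner (\<iota> (\<phi> i)) (\<iota> (\<phi> j)) = 0"
  shows "\<iota> (basis_proj \<phi> m v) = basis_proj (\<lambda>n. \<iota> (\<phi> n)) m (\<iota> v)"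
  by (simp add: basis_proj_def bounded_clinear_sum[OF assms(1)] basis_coeff_embedding[OF assms]
      basis_coeff_orthogonal[OF assms(3,4)])

lemma bounded_linear_sum_scaleC:
  assumes "\<And>j. bounded_linear (f j)"
  shows "bounded_linear (\<lambda>x. \<Sum>j\<in>A. f j x *\<^sub>C e j)"
  by (intro bounded_linear_sum bounded_linear_compose[OF bounded_linear_scaleC_left] assms)

text \<open>For a general Schauder basis, continuity of the coefficients rests on the open mapping
  theorem; here it is visible from their formula as inner products in \<open>H\<close>. A bound
  uniform in \<open>m\<close> comes later, from uniform boundedness.\<close>

lemma bounded_linear_basis_proj:
  assumes "bounded_clinear \<iota>"
    and "schauder_basis \<phi>" and "schauder_basis (\<lambda>n. \<iota> (\<phi> n))"
    and "\<And>i j. i \<noteq> j \<Longrightarrow> cinner (\<iota> (\<phi> i)) (\<iota> (\<phi> j)) = 0"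
  shows "bounded_linear (basis_proj \<phi> m)"
proof -
  have "bounded_linear (\<lambda>v. cinner (\<iota> v) y / z)" for y z
    using assms(1) unfolding bounded_clinear_def
    by (intro bounded_linear_compose[OF bounded_linear_divide]
        bounded_linear_compose[OF bounded_linear_cinner_left]) auto
  from bounded_linear_sum_scaleC[OF this] have
    "bounded_linear (\<lambda>v. \<Sum>j<m. (cinner (\<iota> v) (\<iota> (\<phi> j)) / cinner (\<iota> (\<phi> j)) (\<iota> (\<phi> j))) *\<^sub>C \<phi> j)" .
  then show ?thesis
    by (simp add: basis_proj_def[abs_def] basis_coeff_embedding[OF assms])
qed

lemma bounded_linear_basis_proj_orthogonal:
  assumes "schauder_basis e" and "\<And>i j. i \<noteq> j \<Longrightarrow> cinner (e i) (e j) = 0"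
  shows "bounded_linear (basis_proj e m)"
proof -
  have "bounded_linear (\<lambda>x. cinner x y / z)" for y :: 'a and z
    by (intro bounded_linear_compose[OF bounded_linear_divide] bounded_linear_cinner_left)
  from bounded_linear_sum_scaleC[OF this] have
    "bounded_linear (\<lambda>x. \<Sum>j<m. (cinner x (e j) / cinner (e j) (e j)) *\<^sub>C e j)" .
  then show ?thesis
    by (simp add: basis_proj_def[abs_def] basis_coeff_orthogonal[OF assms])
qed

lemma cinner_basis_proj:
  assumes "schauder_basis e" and "\<And>i j. i \<noteq> j \<Longrightarrow> cinner (e i) (e j) = 0"
  shows "cinner (basis_proj e m x) y = cinner x (basis_proj e m y)"
proof -
  have "cinner (basis_proj e m x) y
      = (\<Sum>j<m. cinner x (e j) * cinner (e j) y / cinner (e j) (e j))"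
    by (simp add: basis_proj_def basis_coeff_orthogonal[OF assms] cinner_sum_left cinner_scaleC_left)
  moreover have "cinner x (basis_proj e m y)
      = cnj (\<Sum>j<m. cinner y (e j) * cinner (e j) x / cinner (e j) (e j))"
    by (subst cinner_commute)
      (simp add: basis_proj_def basis_coeff_orthogonal[OF assms] cinner_sum_left cinner_scaleC_left)
  moreover have "\<dots> = (\<Sum>j<m. cinner x (e j) * cinner (e j) y / cinner (e j) (e j))"
    unfolding cnj_sum complex_cnj_divide complex_cnj_mult cinner_commute[symmetric]
    by (simp add: mult.commute)
  ultimately show ?thesis by simp
qed

lemma basis_proj_idem:
  assumes "schauder_basis e" and "\<And>i j. i \<noteq> j \<Longrightarrow> cinner (e i) (e j) = 0"
  shows "basis_proj e m (basis_proj e m x) = basis_proj e m x"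
proof -
  have "cinner (basis_proj e m x) (e k) = cinner x (e k)" if "k < m" for k
  proof -
    have "cinner (basis_proj e m x) (e k)
        = (\<Sum>j<m. if j = k then cinner x (e k) else 0)"
      unfolding basis_proj_def cinner_sum_left cinner_scaleC_left
      by (intro sum.cong refl)
        (auto simp: assms(2) basis_coeff_orthogonal[OF assms] cinner_self
           schauder_basis_nonzero[OF assms(1)])
    with that show ?thesis by (simp add: sum.delta)
  qed
  then show ?thesis
    by (subst (1 3) basis_proj_def) (simp add: basis_coeff_orthogonal[OF assms])
qed

text \<open>Symmetry and idempotence turn the squared norm of the projection into
  \<open>inner x (basis_proj e m x)\<close>; after Cauchy-Schwarz one factor cancels.\<close>

lemma norm_basis_proj_le:
  assumes "schauder_basis e" and "\<And>i j. i \<noteq> j \<Longrightarrow> cinner (e i) (e j) = 0"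
  shows "norm (basis_proj e m x) \<le> norm x"
proof -
  have "(norm (basis_proj e m x))\<^sup>2 = inner x (basis_proj e m x)"
    unfolding power2_norm_eq_inner Re_cinner[symmetric]
    by (simp add: cinner_basis_proj[OF assms] basis_proj_idem[OF assms])
  also have "\<dots> \<le> norm x * norm (basis_proj e m x)"
    by (rule norm_cauchy_schwarz)
  finally have "norm (basis_proj e m x) * norm (basis_proj e m x) \<le> norm x * norm (basis_proj e m x)"
    by (simp add: power2_eq_square)
  then show ?thesis
    by (metis mult_le_cancel_right norm_ge_zero order.strict_iff_order not_le)
qed

subsection \<open>The principle of uniform boundedness\<close>

text \<open>Baire category argument: pointwise boundedness covers the space by the closed sets
  \<open>S N\<close>, so one of them contains a ball, and subtracting the values at its centre gives
  a common bound on a ball around 0.\<close>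

lemma uniform_boundedness:
  fixes F :: "nat \<Rightarrow> 'a::banach \<Rightarrow> 'b::real_normed_vector"
  assumes lin: "\<And>n. bounded_linear (F n)" and bdd: "\<And>x. bounded (range (\<lambda>n. F n x))"
  obtains K where "K \<ge> 0" and "\<And>n x. norm (F n x) \<le> K * norm x"
proof -
  define S where "S N = {x. \<forall>n. norm (F n x) \<le> real N}" for N
  have closed: "closed (S N)" for N
    unfolding S_def
    by (intro closed_Collect_all closed_Collect_le continuous_intros
        linear_continuous_on[OF lin])
  have cover: "\<Union>(range S) = UNIV"
  proof -
    have "\<exists>N. x \<in> S N" for x
    proof -
      obtain b where b: "norm (F n x) \<le> b" for n
        using bdd[of x] unfolding bounded_iff by auto
      then show ?thesis
        unfolding S_def using real_arch_simple[of b] by (auto intro: order_trans)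
    qed
    then show ?thesis by auto
  qed
  have "\<exists>N. interior (S N) \<noteq> {}"
  proof (rule ccontr)
    assume "\<nexists>N. interior (S N) \<noteq> {}"
    then have "Met_TC.mtopology interior_of \<Union>(range S) = {}"
      using closed by (intro Met_TC.metric_Baire_category_alt) (auto simp: complete_UNIV)
    then show False by (simp add: cover)
  qed
  then obtain N x0 where "x0 \<in> interior (S N)" by blast
  then obtain r where r: "r > 0" "cball x0 r \<subseteq> S N"
    by (auto simp: mem_interior_cball)
  show thesis
  proof
    show "2 * real N / r \<ge> 0" using r by simp
    fix n x
    show "norm (F n x) \<le> 2 * real N / r * norm x"
    proof (cases "x = 0")
      case True
      then show ?thesis by (simp add: linear_0 bounded_linear.linear[OF lin])
    next
      case False
      \<comment> \<open>Rescaling to norm \<open>r\<close> keeps \<open>x0 + y\<close> in the closed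
        ball; \<open>F n y\<close> is then a difference of two vectors of norm at most
        \<open>N\<close>, whence the constant \<open>2 * real N / r\<close>.\<close>
      define y where "y = (r / norm x) *\<^sub>R x"
      have "x0 + y \<in> cball x0 r" "x0 \<in> cball x0 r"
        using r False by (auto simp: y_def dist_norm)
      then have "x0 + y \<in> S N" "x0 \<in> S N"
        using r(2) by blast+
      then have "norm (F n (x0 + y)) \<le> real N" "norm (F n x0) \<le> real N"
        by (auto simp: S_def)
      moreover have "F n y = F n (x0 + y) - F n x0"
        by (simp add: linear_add bounded_linear.linear[OF lin])
      ultimately have "norm (F n y) \<le> 2 * real N"
        using norm_triangle_ineq4[of "F n (x0 + y)" "F n x0"] by simp
      moreover have "norm (F n y) = r / norm x * norm (F n x)"
        using r False by (simp add: y_def linear_cmul bounded_linear.linear[OF lin])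
      ultimately show ?thesis
        using r False by (simp add: field_simps)
    qed
  qed
qed

subsection \<open>Weak derivatives\<close>

text \<open>
  \<open>smoothstep\<close> is a primitive of \<open>hat\<close>, of class \<open>C\<^sup>1\<close>, rising from \<open>0\<close> at \<open>0\<close> to \<open>1\<close> at \<open>2\<close>; the admissible test
  functions below are differences of rescaled copies of it.
\<close>

definition hat :: "real \<Rightarrow> real" where
  "hat x = max 0 x - 2 * max 0 (x - 1) + max 0 (x - 2)"

definition smoothstep :: "real \<Rightarrow> real" where
  "smoothstep x = ((max 0 x)\<^sup>2 - 2 * (max 0 (x - 1))\<^sup>2 + (max 0 (x - 2))\<^sup>2) / 2"

text \<open>Away from 0 the function is locally 0 or the square. At 0 the difference quotient is
  \<open>max 0 h\<close>, which tends to 0: squaring smooths the kink.\<close>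

lemma has_real_derivative_max0_sq: "((\<lambda>x. (max 0 x)\<^sup>2) has_real_derivative 2 * max 0 x) (at x)"
proof -
  consider "x < 0" | "x = 0" | "x > 0" by linarith
  then show ?thesis
  proof cases
    case 1
    have "((\<lambda>x. 0::real) has_real_derivative 2 * max 0 x) (at x)"
      using 1 by simp
    then show ?thesis
      by (rule has_field_derivative_transform_within_open[where S = "{..<0}"]) (use 1 in auto)
  next
    case 2
    have "(\<lambda>h. max 0 h) \<midarrow>0\<rightarrow> max 0 (0::real)"
      by (intro tendsto_intros)
    moreover have "((max 0 (0 + h))\<^sup>2 - (max 0 0)\<^sup>2) / h = max 0 h" for h :: real
      by (cases "h > 0") (auto simp: power2_eq_square max_def)
    ultimately show ?thesis
      by (simp add: 2 DERIV_def)
  next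
    case 3
    have "((\<lambda>x. x\<^sup>2) has_real_derivative 2 * max 0 x) (at x)"
      using 3 by (auto intro!: derivative_eq_intros)
    then show ?thesis
      by (rule has_field_derivative_transform_within_open[where S = "{0<..}"]) (use 3 in auto)
  qed
qed

lemma DERIV_smoothstep: "(smoothstep has_real_derivative hat x) (at x)"
proof -
  have "((\<lambda>x. (max 0 (x - c))\<^sup>2) has_real_derivative 2 * max 0 (x - c)) (at x)" for c :: real
  proof -
    have "((\<lambda>x. x - c) has_real_derivative 1) (at x)"
      by (auto intro!: derivative_eq_intros)
    from DERIV_chain2[OF has_real_derivative_max0_sq this] show ?thesis by simp
  qed
  note d = this[of 0, simplified] this[of 1] this[of 2]
  show ?thesis
    unfolding smoothstep_def[abs_def] hat_def
    by (rule derivative_eq_intros d refl | simp)+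
qed

lemma hat_outside: "x \<notin> {0..2} \<Longrightarrow> hat x = 0"
  by (auto simp: hat_def max_def)

lemma hat_nonneg: "hat x \<ge> 0"
  by (auto simp: hat_def max_def)

lemma continuous_on_hat [continuous_intros]:
  "continuous_on S f \<Longrightarrow> continuous_on S (\<lambda>x. hat (f x))"
  unfolding hat_def by (intro continuous_intros)

lemma borel_measurable_hat [measurable]: "hat \<in> borel_measurable borel"
  using continuous_on_hat[OF continuous_on_id] by (intro borel_measurable_continuous_onI)

lemma smoothstep_0: "x \<le> 0 \<Longrightarrow> smoothstep x = 0"
  by (simp add: smoothstep_def)

lemma smoothstep_1: "x \<ge> 2 \<Longrightarrow> smoothstep x = 1"
  by (simp add: smoothstep_def power2_eq_square algebra_simps)

lemma smoothstep_mono: "x \<le> y \<Longrightarrow> smoothstep x \<le> smoothstep y"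
  by (rule DERIV_nonneg_imp_nondecreasing) (auto intro: DERIV_smoothstep hat_nonneg)

lemma abs_smoothstep_le: "\<bar>smoothstep x\<bar> \<le> 1"
  using smoothstep_mono[of "min x 0" x] smoothstep_mono[of x "max x 2"]
  by (simp add: smoothstep_0 smoothstep_1)

lemma has_bochner_integral_hat: "has_bochner_integral lborel hat 1"
proof -
  have "has_bochner_integral lborel (\<lambda>x. hat x * indicator {0..2} x) (smoothstep 2 - smoothstep 0)"
    by (rule has_bochner_integral_FTC_Icc_nonneg)
      (auto intro: DERIV_smoothstep hat_nonneg)
  moreover have "(\<lambda>x. hat x * indicator {0..2} x) = hat"
    using hat_outside by (auto simp: fun_eq_iff indicator_def)
  ultimately show ?thesis by (simp add: smoothstep_0 smoothstep_1)
qed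

lemma integrable_lebesgue_on_continuous:
  fixes f :: "real \<Rightarrow> 'a::{banach, second_countable_topology}"
  assumes "continuous_on {a..b} f"
  shows "integrable (lebesgue_on {a..b}) f"
proof -
  have "integrable lborel (\<lambda>x. indicator {a..b} x *\<^sub>R f x)"
    using borel_integrable_atLeastAtMost'[OF assms] by (simp add: set_integrable_def)
  then show ?thesis
    by (simp add: integrable_restrict_space integrable_completion borel_measurable_integrable)
qed

lemma integrable_indicator_lebesgue_on:
  fixes f :: "real \<Rightarrow> 'a::{banach, second_countable_topology}"
  assumes f: "integrable (lebesgue_on S) f"
  shows "integrable (lebesgue_on S) (\<lambda>x. indicator {p<..q} x *\<^sub>R f x)"
proof (rule Bochner_Integration.integrable_bound[OF f])
  have [measurable]: "(\<lambda>x. x) \<in> borel_measurable (lebesgue_on S)"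
    by (intro measurable_restrict_space1 measurable_completion) simp
  have [measurable]: "f \<in> borel_measurable (lebesgue_on S)"
    using f by auto
  show "(\<lambda>x. indicator {p<..q} x *\<^sub>R f x) \<in> borel_measurable (lebesgue_on S)"
    by measurable
qed (auto simp: indicator_def)

text \<open>The kernels form an approximate identity whose mass sits in \<open>[r, r + 2/n]\<close>,
  to the right of \<open>r\<close>; this is why \<open>r = s\<close> is allowed while
  \<open>r < T\<close> is strict. Substituting \<open>r + y / n\<close> for \<tau> reduces the limit
  to dominated convergence.\<close>

lemma hat_approximation:
  fixes u :: "real \<Rightarrow> 'a::{banach, second_countable_topology}"
  assumes u: "continuous_on {s..T} u" and r: "s \<le> r" "r < T"
  shows "(\<lambda>n. LINT \<tau>|lebesgue_on {s..T}. (real n * hat (real n * (\<tau> - r))) *\<^sub>R u \<tau>) \<longlonglongrightarrow> u r"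
proof -
  \<comment> \<open>\<open>v\<close> extends \<open>u\<close> by its end values to a bounded
    continuous function on the line, so that \<open>v (r + y / real n)\<close> behaves well for all
    \<open>n\<close> and \<open>y\<close>.\<close>
  define v where "v \<tau> = u (max s (min T \<tau>))" for \<tau>
  have v: "continuous_on UNIV v"
    unfolding v_def using r
    by (intro continuous_on_compose2[OF u] continuous_intros) auto
  have v_eq: "v \<tau> = u \<tau>" if "\<tau> \<in> {s..T}" for \<tau>
    using that by (simp add: v_def)
  have meas_v [measurable]: "v \<in> borel_measurable borel"
    using v by (rule borel_measurable_continuous_onI)
  obtain K where K: "\<And>\<tau>. norm (v \<tau>) \<le> K"
  proof -
    have "bounded (u ` {s..T})"
      using compact_continuous_image[OF u] compact_imp_bounded by blast
    then obtain K where "\<And>\<tau>. \<tau> \<in> {s..T} \<Longrightarrow> norm (u \<tau>) \<le> K"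
      unfolding bounded_iff by blast
    then show thesis using r by (intro that[of K]) (auto simp: v_def)
  qed
  have "(\<lambda>n. LINT y|lborel. hat y *\<^sub>R v (r + y / real n)) \<longlonglongrightarrow> (LINT y|lborel. hat y *\<^sub>R v r)"
  proof (rule integral_dominated_convergence[where w = "\<lambda>y. hat y * K"])
    show "integrable lborel (\<lambda>y. hat y * K)"
      using has_bochner_integral_hat by (intro integrable_mult_left) (auto simp: has_bochner_integral_iff)
    show "AE y in lborel. (\<lambda>n. hat y *\<^sub>R v (r + y / real n)) \<longlonglongrightarrow> hat y *\<^sub>R v r"
    proof (intro AE_I2 tendsto_intros)
      fix y
      have "(\<lambda>n. r + y / real n) \<longlonglongrightarrow> r + 0"
        by (intro tendsto_intros lim_const_over_n)
      then show "(\<lambda>n. v (r + y / real n)) \<longlonglongrightarrow> v r"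
        using continuous_on_tendsto_compose[OF v] by auto
    qed
    show "AE y in lborel. norm (hat y *\<^sub>R v (r + y / real n)) \<le> hat y * K" for n
      using K hat_nonneg by (auto intro!: mult_left_mono)
  qed measurable
  moreover have "(LINT y|lborel. hat y *\<^sub>R v r) = u r"
    using has_bochner_integral_hat v_eq[of r] r
    by (simp add: has_bochner_integral_iff)
  \<comment> \<open>Once \<open>r + 2 / real n < T\<close>, the support of the kernel lies in
    \<open>{s..T}\<close>, so that passing to the whole line and from \<open>u\<close> to
    \<open>v\<close> changes nothing. Positivity of \<open>n\<close> is for the change of
    variables.\<close>
  moreover have "\<forall>\<^sub>F n in sequentially. (LINT y|lborel. hat y *\<^sub>R v (r + y / real n)) =
      (LINT \<tau>|lebesgue_on {s..T}. (real n * hat (real n * (\<tau> - r))) *\<^sub>R u \<tau>)"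
  proof -
    have "(\<lambda>n. r + 2 / real n) \<longlonglongrightarrow> r + 0"
      by (intro tendsto_intros lim_const_over_n)
    then have "\<forall>\<^sub>F n in sequentially. r + 2 / real n < T"
      using r by (intro order_tendstoD) auto
    then show ?thesis
      using eventually_gt_at_top[of 0]
    proof eventually_elim
      case (elim n)
      have "(LINT \<tau>|lebesgue_on {s..T}. (real n * hat (real n * (\<tau> - r))) *\<^sub>R u \<tau>)
          = (LINT \<tau>|lebesgue. indicator {s..T} \<tau> *\<^sub>R (real n * hat (real n * (\<tau> - r))) *\<^sub>R u \<tau>)"
        by (simp add: integral_restrict_space)
      also have "\<dots> = (LINT \<tau>|lebesgue. (real n * hat (real n * (\<tau> - r))) *\<^sub>R v \<tau>)"
      proof (rule Bochner_Integration.integral_cong[OF refl])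
        fix \<tau>
        have "hat (real n * (\<tau> - r)) = 0" if "\<tau> \<notin> {s..T}"
        proof (rule hat_outside)
          show "real n * (\<tau> - r) \<notin> {0..2}"
          proof
            assume "real n * (\<tau> - r) \<in> {0..2}"
            then have "\<tau> \<ge> r" "\<tau> \<le> r + 2 / real n"
              using elim by (auto simp: field_simps zero_le_mult_iff)
            then show False using that r elim by auto
          qed
        qed
        then show "indicator {s..T} \<tau> *\<^sub>R (real n * hat (real n * (\<tau> - r))) *\<^sub>R u \<tau>
            = (real n * hat (real n * (\<tau> - r))) *\<^sub>R v \<tau>"
          using v_eq[of \<tau>] by (auto simp: indicator_def)
      qed
      also have "\<dots> = (LINT \<tau>|lborel. (real n * hat (real n * (\<tau> - r))) *\<^sub>R v \<tau>)"
        by (rule integral_completion) measurable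
      also have "\<dots> = \<bar>1 / real n\<bar> *\<^sub>R
          (LINT y|lborel. (real n * hat (real n * (r + 1 / real n * y - r))) *\<^sub>R v (r + 1 / real n * y))"
        using elim by (intro lborel_integral_real_affine) auto
      also have "\<dots> = \<bar>1 / real n\<bar> *\<^sub>R (real n *\<^sub>R (LINT y|lborel. hat y *\<^sub>R v (r + y / real n)))"
        using elim by (simp add: scaleR_scaleR[symmetric] del: scaleR_scaleR)
      also have "\<dots> = (LINT y|lborel. hat y *\<^sub>R v (r + y / real n))"
        using elim by simp
      finally show ?case by simp
    qed
  qed
  ultimately show ?thesis
    by (simp add: tendsto_cong)
qed

lemma weak_derivative_FTC:
  fixes u g :: "real \<Rightarrow> 'a::{banach, second_countable_topology}"
  assumes u: "continuous_on {s..T} u" and g: "integrable (lebesgue_on {s..T}) g"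
    and weak: "weak_derivative_on s T u g" and rt: "s < r" "r \<le> t" "t < T"
  shows "u t - u r = (LINT \<tau>|lebesgue_on {s..T}. indicator {r<..t} \<tau> *\<^sub>R g \<tau>)"
proof -
  \<comment> \<open>\<open>?\<psi> n\<close> tends to the indicator of \<open>(r, t]\<close>, and \<open>?\<psi>' n\<close> to the difference of the Dirac measures at \<open>r\<close> and \<open>t\<close>.\<close>
  let ?M = "lebesgue_on {s..T}"
  let ?\<psi> = "\<lambda>n \<tau>. smoothstep (real n * (\<tau> - r)) - smoothstep (real n * (\<tau> - t))"
  let ?\<psi>' = "\<lambda>n \<tau>. real n * hat (real n * (\<tau> - r)) - real n * hat (real n * (\<tau> - t))"
  let ?J = "\<lambda>n r. LINT \<tau>|?M. (real n * hat (real n * (\<tau> - r))) *\<^sub>R u \<tau>"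
  have [measurable]: "g \<in> borel_measurable ?M"
    using g by auto
  have smooth_cont: "continuous_on UNIV smoothstep"
    using DERIV_smoothstep DERIV_continuous_on has_field_derivative_at_within by blast
  then have [measurable]: "smoothstep \<in> borel_measurable borel"
    by (rule borel_measurable_continuous_onI)
  have [measurable]: "(\<lambda>\<tau>. \<tau>) \<in> borel_measurable ?M"
    by (intro measurable_restrict_space1 measurable_completion) simp
  have deriv: "(?\<psi> n has_real_derivative ?\<psi>' n \<tau>) (at \<tau>)" for n \<tau>
    by (rule derivative_eq_intros DERIV_chain2[OF DERIV_smoothstep] refl | simp)+
  have "(\<lambda>n. LINT \<tau>|?M. ?\<psi> n \<tau> *\<^sub>R g \<tau>) \<longlonglongrightarrow> (LINT \<tau>|?M. indicator {r<..t} \<tau> *\<^sub>R g \<tau>)"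
  proof (rule integral_dominated_convergence[where w = "\<lambda>\<tau>. 2 * norm (g \<tau>)"])
    show "integrable ?M (\<lambda>\<tau>. 2 * norm (g \<tau>))"
      using g by auto
    show "AE \<tau> in ?M. (\<lambda>n. ?\<psi> n \<tau> *\<^sub>R g \<tau>) \<longlonglongrightarrow> indicator {r<..t} \<tau> *\<^sub>R g \<tau>"
    proof (intro AE_I2 tendsto_intros)
      fix \<tau>
      \<comment> \<open>At \<open>\<tau> = c\<close> the value is 0 for every \<open>n\<close>,
        which is why half-open intervals \<open>{r<..t}\<close> appear; to the right of
        \<open>c\<close> it is 1 as soon as \<open>n \<ge> 2 / (\<tau> - c)\<close>.\<close>
      have step: "(\<lambda>n. smoothstep (real n * (\<tau> - c))) \<longlonglongrightarrow> indicator {c<..} \<tau>" for c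
      proof (cases "\<tau> > c")
        case True
        have "\<forall>\<^sub>F n in sequentially. real n \<ge> 2 / (\<tau> - c)"
          by (metis eventually_ge_at_top filterlim_at_top filterlim_real_sequentially)
        then have "\<forall>\<^sub>F n in sequentially. smoothstep (real n * (\<tau> - c)) = indicator {c<..} \<tau>"
          by eventually_elim (use True in \<open>auto simp: field_simps intro!: smoothstep_1\<close>)
        then show ?thesis by (rule tendsto_eventually)
      next
        case False
        then have "smoothstep (real n * (\<tau> - c)) = indicator {c<..} \<tau>" for n
          by (auto intro!: smoothstep_0 simp: mult_nonneg_nonpos)
        then show ?thesis by simp
      qed
      have "indicator {r<..t} \<tau> = (indicator {r<..} \<tau> - indicator {t<..} \<tau> :: real)"
        using rt by (auto simp: indicator_def)
      then show "(\<lambda>n. ?\<psi> n \<tau>) \<longlonglongrightarrow> indicator {r<..t} \<tau>"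
        using tendsto_diff[OF step[of r] step[of t]] by simp
    qed
    show "AE \<tau> in ?M. norm (?\<psi> n \<tau> *\<^sub>R g \<tau>) \<le> 2 * norm (g \<tau>)" for n
    proof (intro AE_I2)
      fix \<tau>
      have "\<bar>?\<psi> n \<tau>\<bar> \<le> 2"
        using abs_smoothstep_le[of "real n * (\<tau> - r)"] abs_smoothstep_le[of "real n * (\<tau> - t)"]
        by linarith
      then show "norm (?\<psi> n \<tau> *\<^sub>R g \<tau>) \<le> 2 * norm (g \<tau>)"
        by (auto intro!: mult_right_mono)
    qed
  qed measurable
  \<comment> \<open>The test function vanishes outside \<open>[r, t + 2/n]\<close>. As
    \<open>s < r\<close>, this is a compact subset of the open interval once
    \<open>t + 2 / real n < T\<close>, and the definition of the weak derivative applies.\<close>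
  moreover have "\<forall>\<^sub>F n in sequentially. (LINT \<tau>|?M. ?\<psi> n \<tau> *\<^sub>R g \<tau>) = ?J n t - ?J n r"
  proof -
    have "(\<lambda>n. t + 2 / real n) \<longlonglongrightarrow> t + 0"
      by (intro tendsto_intros lim_const_over_n)
    then have "\<forall>\<^sub>F n in sequentially. t + 2 / real n < T"
      using rt by (intro order_tendstoD) auto
    then show ?thesis
      using eventually_gt_at_top[of 0]
    proof eventually_elim
      case (elim n)
      have "?\<psi> n \<tau> = 0" if "\<tau> \<notin> {r..t + 2 / real n}" for \<tau>
      proof (cases "\<tau> < r")
        case True
        then show ?thesis
          using rt by (simp add: smoothstep_0 mult_nonneg_nonpos)
      next
        case False
        then have "\<tau> - t \<ge> 2 / real n" "\<tau> - r \<ge> 2 / real n"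
          using that rt by auto
        then have "real n * (\<tau> - t) \<ge> 2" "real n * (\<tau> - r) \<ge> 2"
          using elim by (simp_all add: field_simps)
        then show ?thesis by (simp add: smoothstep_1)
      qed
      moreover have "continuous_on UNIV (?\<psi>' n)"
        by (intro continuous_intros)
      ultimately have "(LINT \<tau>|?M. ?\<psi>' n \<tau> *\<^sub>R u \<tau>) = - (LINT \<tau>|?M. ?\<psi> n \<tau> *\<^sub>R g \<tau>)"
        using weak[unfolded weak_derivative_on_def, rule_format, of "?\<psi> n" "?\<psi>' n"] deriv rt elim
        by blast
      moreover have "(LINT \<tau>|?M. ?\<psi>' n \<tau> *\<^sub>R u \<tau>) = ?J n r - ?J n t"
        unfolding scaleR_diff_left
        by (intro Bochner_Integration.integral_diff integrable_lebesgue_on_continuous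
            continuous_intros u)
      ultimately show ?case by (simp add: algebra_simps)
    qed
  qed
  ultimately have "(\<lambda>n. ?J n t - ?J n r) \<longlonglongrightarrow> (LINT \<tau>|?M. indicator {r<..t} \<tau> *\<^sub>R g \<tau>)"
    by (simp add: tendsto_cong)
  from LIMSEQ_unique[OF _ this, of "u t - u r"] show ?thesis
    using rt by (simp add: tendsto_diff hat_approximation[OF u])
qed

subsection \<open>Energy estimates\<close>

text \<open>The interval is cut into pieces of length at most \<delta>, the local bounds are added
  and their right-hand sides telescope. The induction runs over the number of pieces, peeling off
  the last one.\<close>

lemma telescoping_bound:
  fixes D N :: "real \<Rightarrow> real"
  assumes "r \<le> t" and "\<delta> > 0"
    and step: "\<And>p q. r \<le> p \<Longrightarrow> p \<le> q \<Longrightarrow> q \<le> t \<Longrightarrow> q - p \<le> \<delta> \<Longrightarrow> \<bar>D q - D p\<bar> \<le> N q - N p"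
  shows "\<bar>D t - D r\<bar> \<le> N t - N r"
proof -
  have "\<bar>D p - D r\<bar> \<le> N p - N r" if "r \<le> p" "p \<le> t" "p - r \<le> real n * \<delta>" for p n
    using that
  proof (induction n arbitrary: p)
    case 0
    then show ?case using step[of r p] assms by simp
  next
    case (Suc n)
    show ?case
    proof (cases "p - r \<le> \<delta>")
      case True
      then show ?thesis using step[of r p] Suc.prems by simp
    next
      case False
      then have "\<bar>D (p - \<delta>) - D r\<bar> \<le> N (p - \<delta>) - N r"
        using Suc.prems assms by (intro Suc.IH) (auto simp: algebra_simps)
      moreover have "\<bar>D p - D (p - \<delta>)\<bar> \<le> N p - N (p - \<delta>)"
        using Suc.prems assms False by (intro step) auto
      ultimately show ?thesis by linarith
    qed
  qed
  moreover obtain n where "(t - r) / \<delta> \<le> real n"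
    using real_arch_simple by blast
  ultimately show ?thesis
    using assms by (auto simp: field_simps)
qed

text \<open>A product rule for the squared norm that avoids pointwise differentiation.
  \<open>D\<close> is the squared norm minus its expected primitive, \<open>N\<close> a primitive of
  the norm of \<open>g\<close>. Uniform continuity of \<open>e\<close> bounds increments of
  \<open>D\<close> on short intervals by \<open>2 * \<epsilon>\<close> times those of
  \<open>N\<close>; the bounds add up, and letting \<epsilon> tend to 0 gives
  \<open>D t = D r\<close>.\<close>

lemma energy_identity:
  fixes e g :: "real \<Rightarrow> 'a::{real_inner, banach, second_countable_topology}"
  assumes e: "continuous_on {s..T} e" and g: "integrable (lebesgue_on {s..T}) g"
    and FTC: "\<And>r t. s < r \<Longrightarrow> r \<le> t \<Longrightarrow> t < T \<Longrightarrow>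
        e t - e r = (LINT \<tau>|lebesgue_on {s..T}. indicator {r<..t} \<tau> *\<^sub>R g \<tau>)"
    and rt: "s < r" "r \<le> t" "t < T"
  shows "(norm (e t))\<^sup>2 - (norm (e r))\<^sup>2
    = (LINT \<tau>|lebesgue_on {s..T}. indicator {r<..t} \<tau> * (2 * inner (g \<tau>) (e \<tau>)))"
    and "integrable (lebesgue_on {s..T}) (\<lambda>\<tau>. inner (g \<tau>) (e \<tau>))"
proof -
  let ?M = "lebesgue_on {s..T}"
  have meas_g [measurable]: "g \<in> borel_measurable ?M"
    using g by auto
  have meas_e [measurable]: "e \<in> borel_measurable ?M"
    using integrable_lebesgue_on_continuous[OF e] by auto
  obtain K where K: "\<And>\<tau>. \<tau> \<in> {s..T} \<Longrightarrow> norm (e \<tau>) \<le> K"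
    using compact_imp_bounded[OF compact_continuous_image[OF e compact_Icc]]
    unfolding bounded_iff by blast
  show int_ge: "integrable ?M (\<lambda>\<tau>. inner (g \<tau>) (e \<tau>))"
  proof (rule Bochner_Integration.integrable_bound[of _ "\<lambda>\<tau>. K * norm (g \<tau>)"])
    show "AE \<tau> in ?M. norm (inner (g \<tau>) (e \<tau>)) \<le> norm (K * norm (g \<tau>))"
    proof (intro AE_I2)
      fix \<tau> assume "\<tau> \<in> space ?M"
      then have \<tau>: "norm (e \<tau>) \<le> K" using K by simp
      have "\<bar>inner (g \<tau>) (e \<tau>)\<bar> \<le> norm (g \<tau>) * norm (e \<tau>)"
        by (rule Cauchy_Schwarz_ineq2)
      also have "\<dots> \<le> norm (g \<tau>) * K"
        using \<tau> by (intro mult_left_mono) auto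
      also have "\<dots> \<le> norm (K * norm (g \<tau>))"
        using norm_ge_zero[of "e \<tau>"] \<tau> by (simp add: abs_mult mult.commute del: norm_ge_zero)
      finally show "norm (inner (g \<tau>) (e \<tau>)) \<le> norm (K * norm (g \<tau>))" by simp
    qed
  qed (use g in auto)
  note int_ind = integrable_indicator_lebesgue_on
  define D where "D p = (norm (e p))\<^sup>2 - (LINT \<tau>|?M. indicator {s<..p} \<tau> *\<^sub>R (2 * inner (g \<tau>) (e \<tau>)))" for p
  define N where "N p = (LINT \<tau>|?M. indicator {s<..p} \<tau> *\<^sub>R norm (g \<tau>))" for p
  have split: "(LINT \<tau>|?M. indicator {s<..q} \<tau> *\<^sub>R f \<tau>) - (LINT \<tau>|?M. indicator {s<..p} \<tau> *\<^sub>R f \<tau>)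
      = (LINT \<tau>|?M. indicator {p<..q} \<tau> *\<^sub>R f \<tau>)"
    if "s < p" "p \<le> q" "integrable ?M f" for p q and f :: "real \<Rightarrow> real"
  proof -
    have "(LINT \<tau>|?M. indicator {s<..q} \<tau> *\<^sub>R f \<tau>) - (LINT \<tau>|?M. indicator {s<..p} \<tau> *\<^sub>R f \<tau>)
      = (LINT \<tau>|?M. indicator {s<..q} \<tau> *\<^sub>R f \<tau> - indicator {s<..p} \<tau> *\<^sub>R f \<tau>)"
      using that by (intro Bochner_Integration.integral_diff[symmetric] int_ind)
    also have "\<dots> = (LINT \<tau>|?M. indicator {p<..q} \<tau> *\<^sub>R f \<tau>)"
      using that by (intro Bochner_Integration.integral_cong) (auto simp: indicator_def)
    finally show ?thesis .
  qed
  have le: "\<bar>D t - D r\<bar> \<le> \<epsilon> * (2 * (N t - N r))" if \<epsilon>: "\<epsilon> > 0" for \<epsilon>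
  proof -
    obtain \<delta> where \<delta>: "\<delta> > 0"
      "\<And>p q. p \<in> {s..T} \<Longrightarrow> q \<in> {s..T} \<Longrightarrow> dist q p < \<delta> \<Longrightarrow> dist (e q) (e p) < \<epsilon>"
      using compact_uniformly_continuous[OF e] \<epsilon> unfolding uniformly_continuous_on_def by fastforce
    \<comment> \<open>On a short interval \<open>{p..q}\<close> the vector \<open>e p + e q\<close> is within \<open>2 * \<epsilon>\<close> of \<open>2 *\<^sub>R e \<tau>\<close>.\<close>
    have "\<bar>D t - D r\<bar> \<le> 2 * \<epsilon> * N t - 2 * \<epsilon> * N r"
    proof (rule telescoping_bound[where \<delta> = "\<delta> / 2"])
      fix p q assume pq: "r \<le> p" "p \<le> q" "q \<le> t" "q - p \<le> \<delta> / 2"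
      \<comment> \<open>This factorisation lets the integral formula for \<open>e q - e p\<close>
        enter, with the constant vector \<open>e p + e q\<close> standing in for
        \<open>2 *\<^sub>R e \<tau>\<close>.\<close>
      have "(norm (e q))\<^sup>2 - (norm (e p))\<^sup>2 = inner (e q - e p) (e p + e q)"
        by (simp add: power2_norm_eq_inner inner_diff_left inner_add_right inner_commute[of "e q" "e p"])
      also have "\<dots> = (LINT \<tau>|?M. inner (indicator {p<..q} \<tau> *\<^sub>R g \<tau>) (e p + e q))"
        using pq rt FTC[of p q] integral_inner_left[of "e p + e q" ?M, OF int_ind[OF g]]
        by (simp del: inner_scaleR_left)
      finally have diff: "(norm (e q))\<^sup>2 - (norm (e p))\<^sup>2
          = (LINT \<tau>|?M. inner (indicator {p<..q} \<tau> *\<^sub>R g \<tau>) (e p + e q))" .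
      have "D q - D p = (norm (e q))\<^sup>2 - (norm (e p))\<^sup>2
          - (LINT \<tau>|?M. indicator {p<..q} \<tau> *\<^sub>R (2 * inner (g \<tau>) (e \<tau>)))"
        using split[of p q "\<lambda>\<tau>. 2 * inner (g \<tau>) (e \<tau>)"] pq rt int_ge
        by (simp add: D_def)
      also have "\<dots> = (LINT \<tau>|?M. inner (indicator {p<..q} \<tau> *\<^sub>R g \<tau>) (e p + e q)
          - indicator {p<..q} \<tau> *\<^sub>R (2 * inner (g \<tau>) (e \<tau>)))"
        unfolding diff by (intro Bochner_Integration.integral_diff[symmetric] int_ind
            integrable_inner_left integrable_mult_right g int_ge)
      finally have D: "D q - D p = \<dots>" .
      have "\<bar>D q - D p\<bar> \<le> (LINT \<tau>|?M. 2 * \<epsilon> * (indicator {p<..q} \<tau> *\<^sub>R norm (g \<tau>)))"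
        unfolding D real_norm_def[symmetric]
      proof (rule order_trans[OF integral_norm_bound integral_mono])
        show "integrable ?M (\<lambda>\<tau>. norm (inner (indicator {p<..q} \<tau> *\<^sub>R g \<tau>) (e p + e q)
          - indicator {p<..q} \<tau> *\<^sub>R (2 * inner (g \<tau>) (e \<tau>))))"
          by (intro integrable_norm Bochner_Integration.integrable_diff int_ind integrable_inner_left
              integrable_mult_right g int_ge)
        show "integrable ?M (\<lambda>\<tau>. 2 * \<epsilon> * (indicator {p<..q} \<tau> *\<^sub>R norm (g \<tau>)))"
          by (intro integrable_mult_right int_ind integrable_norm g)
        fix \<tau>
        show "norm (inner (indicator {p<..q} \<tau> *\<^sub>R g \<tau>) (e p + e q)
            - indicator {p<..q} \<tau> *\<^sub>R (2 * inner (g \<tau>) (e \<tau>)))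
          \<le> 2 * \<epsilon> * (indicator {p<..q} \<tau> *\<^sub>R norm (g \<tau>))"
        proof (cases "\<tau> \<in> {p<..q}")
          case True
          then have "dist (e p) (e \<tau>) < \<epsilon>" "dist (e q) (e \<tau>) < \<epsilon>"
            using pq rt \<delta> by (auto intro!: \<delta>(2) simp: dist_real_def)
          then have "norm ((e p - e \<tau>) + (e q - e \<tau>)) \<le> 2 * \<epsilon>"
            using norm_triangle_ineq[of "e p - e \<tau>" "e q - e \<tau>"] by (simp add: dist_norm)
          then have "norm (g \<tau>) * norm ((e p - e \<tau>) + (e q - e \<tau>)) \<le> norm (g \<tau>) * (2 * \<epsilon>)"
            by (intro mult_left_mono) auto
          then have "\<bar>inner (g \<tau>) ((e p - e \<tau>) + (e q - e \<tau>))\<bar> \<le> norm (g \<tau>) * (2 * \<epsilon>)"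
            using Cauchy_Schwarz_ineq2 order_trans by blast
          with True show ?thesis
            by (simp add: inner_add_right inner_diff_right algebra_simps)
        qed simp
      qed
      also have "\<dots> = 2 * \<epsilon> * (LINT \<tau>|?M. indicator {p<..q} \<tau> *\<^sub>R norm (g \<tau>))"
        by (rule integral_mult_right_zero)
      also have "\<dots> = 2 * \<epsilon> * (N q - N p)"
        using split[of p q "\<lambda>\<tau>. norm (g \<tau>)"] pq rt g by (simp add: N_def)
      also have "\<dots> = 2 * \<epsilon> * N q - 2 * \<epsilon> * N p"
        by (rule right_diff_distrib)
      finally show "\<bar>D q - D p\<bar> \<le> 2 * \<epsilon> * N q - 2 * \<epsilon> * N p" .
    qed (use \<delta> rt in auto)
    then show ?thesis by (simp add: algebra_simps)
  qed
  have "\<bar>D t - D r\<bar> \<le> \<epsilon>" if "\<epsilon> > 0" for \<epsilon>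
  proof -
    \<comment> \<open>The bound \<open>le\<close> is applied with \<epsilon> divided by this number;
      adding 1 keeps the divisor positive.\<close>
    have pos: "\<bar>2 * (N t - N r)\<bar> + 1 > 0" by linarith
    have "\<bar>D t - D r\<bar> \<le> \<epsilon> / (\<bar>2 * (N t - N r)\<bar> + 1) * (2 * (N t - N r))"
      by (intro le divide_pos_pos that pos)
    also have "\<dots> \<le> \<epsilon> / (\<bar>2 * (N t - N r)\<bar> + 1) * (\<bar>2 * (N t - N r)\<bar> + 1)"
      using that pos by (intro mult_left_mono) auto
    also have "\<dots> = \<epsilon>"
      using pos by simp
    finally show ?thesis .
  qed
  then have "D t = D r"
    using field_le_epsilon[of "\<bar>D t - D r\<bar>" 0] by simp
  then show "(norm (e t))\<^sup>2 - (norm (e r))\<^sup>2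
      = (LINT \<tau>|?M. indicator {r<..t} \<tau> * (2 * inner (g \<tau>) (e \<tau>)))"
    using split[of r t "\<lambda>\<tau>. 2 * inner (g \<tau>) (e \<tau>)"] rt int_ge by (simp add: D_def)
qed

text \<open>The energy identity holds between interior points, where \<open>G \<ge> 0\<close> lets
  the integral grow to the whole interval. The end points are then reached by continuity of the
  norm.\<close>

lemma energy_inequality:
  fixes e g :: "real \<Rightarrow> 'a::{real_inner, banach, second_countable_topology}"
  assumes e: "continuous_on {s..T} e" and g: "integrable (lebesgue_on {s..T}) g"
    and FTC: "\<And>r t. s < r \<Longrightarrow> r \<le> t \<Longrightarrow> t < T \<Longrightarrow>
        e t - e r = (LINT \<tau>|lebesgue_on {s..T}. indicator {r<..t} \<tau> *\<^sub>R g \<tau>)"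
    and G: "integrable (lebesgue_on {s..T}) G" "\<And>\<tau>. G \<tau> \<ge> 0"
    and le: "AE \<tau> in lebesgue_on {s..T}. 2 * inner (g \<tau>) (e \<tau>) \<le> G \<tau>"
    and t: "s < T" "t \<in> {s..T}"
  shows "(norm (e t))\<^sup>2 \<le> (norm (e s))\<^sup>2 + (LINT \<tau>|lebesgue_on {s..T}. G \<tau>)"
proof -
  let ?M = "lebesgue_on {s..T}"
  have interior: "(norm (e q))\<^sup>2 \<le> (norm (e p))\<^sup>2 + (LINT \<tau>|?M. G \<tau>)"
    if "s < p" "p \<le> q" "q < T" for p q
  proof -
    have "(LINT \<tau>|?M. indicator {p<..q} \<tau> *\<^sub>R (2 * inner (g \<tau>) (e \<tau>))) \<le> (LINT \<tau>|?M. G \<tau>)"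
    proof (rule integral_mono_AE)
      show "integrable ?M (\<lambda>\<tau>. indicator {p<..q} \<tau> *\<^sub>R (2 * inner (g \<tau>) (e \<tau>)))"
        by (intro integrable_indicator_lebesgue_on integrable_mult_right
            energy_identity(2)[OF e g FTC that])
      show "AE \<tau> in ?M. indicator {p<..q} \<tau> *\<^sub>R (2 * inner (g \<tau>) (e \<tau>)) \<le> G \<tau>"
        using le by eventually_elim (use G(2) in \<open>auto simp: indicator_def\<close>)
    qed (rule G)
    then show ?thesis
      using energy_identity(1)[OF e g FTC that] by simp
  qed
  have cont: "continuous_on {s..T} (\<lambda>\<tau>. (norm (e \<tau>))\<^sup>2)"
    by (intro continuous_intros e)
  show ?thesis
  proof (rule field_le_epsilon)
    fix \<epsilon> :: real assume "\<epsilon> > 0"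
    then obtain \<delta> where \<delta>: "\<delta> > 0" "\<And>p q. p \<in> {s..T} \<Longrightarrow> q \<in> {s..T} \<Longrightarrow> dist q p < \<delta> \<Longrightarrow>
        dist ((norm (e q))\<^sup>2) ((norm (e p))\<^sup>2) < \<epsilon> / 2"
      using compact_uniformly_continuous[OF cont] unfolding uniformly_continuous_on_def
      by (metis compact_Icc half_gt_zero)
    \<comment> \<open>\<open>s + d\<close> replaces \<open>s\<close>, and \<open>q\<close> is
      \<open>t\<close> clamped to \<open>[s + d, T - d]\<close>. The factor 1/3 keeps this interval
      nonempty and moves each point by less than \<delta>.\<close>
    define d where "d = min \<delta> (T - s) / 3"
    define q where "q = max (s + d) (min (T - d) t)"
    have d: "d > 0" "d < \<delta>" "3 * d \<le> T - s"
      using \<delta> t by (auto simp: d_def)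
    then have q: "s < q" "q < T" "s + d \<le> q" "\<bar>q - t\<bar> < \<delta>"
      using t by (auto simp: q_def)
    have "dist ((norm (e q))\<^sup>2) ((norm (e t))\<^sup>2) < \<epsilon> / 2"
      using q t by (intro \<delta>(2)) (auto simp: dist_real_def)
    moreover have "dist ((norm (e (s + d)))\<^sup>2) ((norm (e s))\<^sup>2) < \<epsilon> / 2"
      using d t by (intro \<delta>(2)) (auto simp: dist_real_def)
    moreover have "(norm (e q))\<^sup>2 \<le> (norm (e (s + d)))\<^sup>2 + (LINT \<tau>|?M. G \<tau>)"
      using q d by (intro interior) auto
    ultimately show "(norm (e t))\<^sup>2 \<le> (norm (e s))\<^sup>2 + (LINT \<tau>|?M. G \<tau>) + \<epsilon>"
      unfolding dist_real_def abs_less_iff by linarith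
  qed
qed

text \<open>The estimate at a fixed time: \<open>w\<close> and \<open>w'\<close> are values of the
  exact and the approximate solution, \<open>g\<close> and \<open>g'\<close> their time derivatives.
  For \<open>z = w' - w\<close> the approximate form is block diagonal with respect to
  \<open>P z\<close> and \<open>z - P z\<close>, so its coercivity controls \<open>p\<close> and
  \<open>q\<close> separately and absorbs all terms linear in them.\<close>

lemma form_energy_estimate:
  fixes \<iota> :: "'v::complex_inner \<Rightarrow> 'h::complex_inner" and b :: "'v \<Rightarrow> 'v \<Rightarrow> complex"
  assumes \<iota>: "linear \<iota>" and c: "\<And>v. norm (\<iota> v) \<le> c * norm v" "c \<ge> 0"
    and b: "sesquilinear b" and b_le: "\<And>u v. norm (b u v) \<le> M * norm u * norm v"
    and coercive: "\<And>u. Re (b u u) \<ge> \<alpha> * (norm u)\<^sup>2" and \<alpha>: "\<alpha> > 0"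
    and P: "linear P" and PQ: "\<And>v. \<iota> (P v) = Q (\<iota> v)"
    and Q: "\<And>x y. cinner (Q x) y = cinner x (Q y)"
    and w: "\<And>v. b w v = cinner (- g) (\<iota> v)"
    and w': "\<And>v. b (P w') (P v) + complex_of_real \<alpha> * cinner (w' - P w') (v - P v)
        = cinner (- g') (\<iota> v)"
  shows "2 * inner (g' - g) (\<iota> w' - \<iota> w)
    \<le> (M\<^sup>2 / \<alpha> + \<alpha>) * (norm (w - P w))\<^sup>2 + 2 * c\<^sup>2 / \<alpha> * (norm (g - Q g))\<^sup>2"
proof -
  define z where "z = w' - w"
  define p q where "p = norm (P z)" and "q = norm (z - P z)"
  define A B where "A = norm (w - P w)" and "B = norm (g - Q g)"
  have w'_eq: "w' = w + z" by (simp add: z_def)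
  have add_l: "b (u + u') v = b u v + b u' v" and add_r: "b u (v + v') = b u v + b u v'" for u u' v v'
    using b by (auto simp: sesquilinear_def)
  have "cinner (g' - g) (\<iota> z) = b w z - (b (P w') (P z)
      + complex_of_real \<alpha> * cinner (w' - P w') (z - P z))"
    unfolding w w' by (simp add: cinner_diff_left cinner_minus_left)
  also have "b w z = b w (P z) + b w (z - P z)"
    using add_r[of w "P z" "z - P z"] by simp
  also have "b w (P z) = b (P w) (P z) + b (w - P w) (P z)"
    using add_l[of "P w" "w - P w" "P z"] by simp
  \<comment> \<open>The equation for \<open>w\<close> trades \<open>z - P z\<close>, which need not be small in \<open>V\<close>, for \<open>g - Q g\<close>.\<close>
  also have "b w (z - P z) = - cinner (g - Q g) (\<iota> z)"
    unfolding w linear_diff[OF \<iota>] PQ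
    by (simp add: cinner_diff_left cinner_diff_right cinner_minus_left Q)
  also have "b (P w') (P z) = b (P w) (P z) + b (P z) (P z)"
    by (simp add: w'_eq linear_add[OF P] add_l)
  also have "cinner (w' - P w') (z - P z) = cinner (w - P w) (z - P z) + cinner (z - P z) (z - P z)"
    by (simp add: w'_eq linear_add[OF P] cinner_add_left[symmetric] algebra_simps)
  finally have "cinner (g' - g) (\<iota> z) = b (w - P w) (P z) - cinner (g - Q g) (\<iota> z)
      - of_real \<alpha> * cinner (w - P w) (z - P z) - b (P z) (P z) - of_real (\<alpha> * q\<^sup>2)"
    by (simp add: q_def cinner_self algebra_simps)
  from arg_cong[OF this, of Re] have "inner (g' - g) (\<iota> z) = Re (b (w - P w) (P z)) - inner (g - Q g) (\<iota> z)
      - \<alpha> * inner (w - P w) (z - P z) - Re (b (P z) (P z)) - \<alpha> * q\<^sup>2"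
    by (simp add: Re_cinner)
  moreover have "Re (b (w - P w) (P z)) \<le> M * A * p"
    using order_trans[OF complex_Re_le_cmod b_le] by (simp add: A_def p_def)
  moreover have "- inner (g - Q g) (\<iota> z) \<le> B * (c * (p + q))"
  proof -
    have "- inner (g - Q g) (\<iota> z) \<le> B * norm (\<iota> z)"
      using Cauchy_Schwarz_ineq2[of "g - Q g" "\<iota> z"] by (simp add: B_def)
    also have "norm z \<le> p + q"
      using norm_triangle_ineq[of "P z" "z - P z"] by (simp add: p_def q_def)
    then have "norm (\<iota> z) \<le> c * (p + q)"
      using c by (meson mult_left_mono order_trans)
    then have "B * norm (\<iota> z) \<le> B * (c * (p + q))"
      by (intro mult_left_mono) (auto simp: B_def)
    finally show ?thesis .
  qed
  moreover have "- \<alpha> * inner (w - P w) (z - P z) \<le> \<alpha> * (A * q)"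
    using Cauchy_Schwarz_ineq2[of "w - P w" "z - P z"] \<alpha>
      mult_left_mono[of "- inner (w - P w) (z - P z)" "A * q" \<alpha>] by (simp add: A_def q_def)
  moreover have "Re (b (P z) (P z)) \<ge> \<alpha> * p\<^sup>2"
    unfolding p_def by (rule coercive)
  moreover have young: "2 * (x * y) \<le> \<alpha> * y\<^sup>2 + x\<^sup>2 / \<alpha>" for x y
  proof -
    have "0 \<le> (\<alpha> * y - x)\<^sup>2 / \<alpha>" using \<alpha> by simp
    also have "\<dots> = \<alpha> * y\<^sup>2 + x\<^sup>2 / \<alpha> - 2 * (x * y)"
      using \<alpha> by (simp add: power2_eq_square field_simps)
    finally show ?thesis by simp
  qed
  \<comment> \<open>Coercivity of \<open>b\<close> and the complementary inner product supply
    \<open>2 * \<alpha> * p\<^sup>2\<close> and \<open>2 * \<alpha> * q\<^sup>2\<close>; the four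
    mixed terms use each square exactly twice with weight \<alpha>.\<close>
  note young[of "M * A" p] young[of "B * c" p] young[of "B * c" q] young[of "\<alpha> * A" q]
  ultimately have "2 * inner (g' - g) (\<iota> z)
      \<le> (M * A)\<^sup>2 / \<alpha> + (\<alpha> * A)\<^sup>2 / \<alpha> + 2 * ((B * c)\<^sup>2 / \<alpha>)"
    by (simp add: algebra_simps)
  also have "\<dots> = (M\<^sup>2 / \<alpha> + \<alpha>) * A\<^sup>2 + 2 * c\<^sup>2 / \<alpha> * B\<^sup>2"
    using \<alpha> by (simp add: power2_eq_square field_simps)
  finally show ?thesis
    by (simp add: z_def linear_diff[OF \<iota>] A_def B_def)
qed

section \<open>Solutions of the Cauchy problem and their projection errors\<close>

lemma L2_on_imp_integrable:
  fixes f :: "real \<Rightarrow> 'a::{banach, second_countable_topology}"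
  assumes "L2_on s T f"
  shows "integrable (lebesgue_on {s..T}) f"
proof (rule Bochner_Integration.integrable_bound[of _ "\<lambda>t. 1 + (norm (f t))\<^sup>2"])
  show "integrable (lebesgue_on {s..T}) (\<lambda>t. 1 + (norm (f t))\<^sup>2)"
    using assms integrable_lebesgue_on_continuous[of s T "\<lambda>_. 1 :: real"]
    by (intro Bochner_Integration.integrable_add) (auto simp: L2_on_def)
  have "x \<le> 1 + x\<^sup>2" for x :: real
    using zero_le_power2[of "x - 1 / 2"] by (simp add: power2_eq_square algebra_simps)
  then show "AE t in lebesgue_on {s..T}. norm (f t) \<le> norm (1 + (norm (f t))\<^sup>2)"
    by (intro AE_I2) (simp add: abs_of_nonneg)
qed (use assms in \<open>simp add: L2_on_def\<close>)

text \<open>Membership in the graph yields some preimage in \<open>V\<close> satisfying the form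
  equation; injectivity of \<iota> identifies it almost everywhere with the square-integrable
  \<open>w\<close>. The weak derivative is passed on in integrated form.\<close>

lemma solves_cauchy_assoc_opE:
  assumes \<iota>: "inj \<iota>" and sol: "solves_cauchy \<iota> (\<lambda>t. assoc_op \<iota> (b t)) s T x u"
  obtains w g where "L2_on s T w" and "L2_on s T g" and "continuous_on {s..T} u" and "u s = x"
    and "\<And>r t. s < r \<Longrightarrow> r \<le> t \<Longrightarrow> t < T \<Longrightarrow>
      u t - u r = (LINT \<tau>|lebesgue_on {s..T}. indicator {r<..t} \<tau> *\<^sub>R g \<tau>)"
    and "AE t in lebesgue_on {s..T}. u t = \<iota> (w t) \<and> (\<forall>v. b t (w t) v = cinner (- g t) (\<iota> v))"
proof -
  obtain w g where w: "L2_on s T w" "AE t in lebesgue_on {s..T}. \<iota> (w t) = u t"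
    and g: "L2_on s T g" "weak_derivative_on s T u g"
      "AE t in lebesgue_on {s..T}. (u t, - g t) \<in> assoc_op \<iota> (b t)"
    and u: "continuous_on {s..T} u" "u s = x"
    using sol unfolding solves_cauchy_def by blast
  from w(2) g(3) have "AE t in lebesgue_on {s..T}.
      u t = \<iota> (w t) \<and> (\<forall>v. b t (w t) v = cinner (- g t) (\<iota> v))"
    by eventually_elim (auto simp: assoc_op_def inj_eq[OF \<iota>])
  with w(1) g(1) u show thesis
    by (intro that[of w g] weak_derivative_FTC L2_on_imp_integrable g(2))
qed

text \<open>Dominated convergence with majorant
  \<open>(1 + K)\<^sup>2 * (norm (f t))\<^sup>2\<close>. It serves both for the solution in
  \<open>V\<close>, with \<open>K\<close> from uniform boundedness, and for its derivative in
  \<open>H\<close>, with \<open>K = 1\<close>.\<close>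

lemma integral_projection_error_tendsto_0:
  fixes f :: "real \<Rightarrow> 'a::{banach, second_countable_topology}"
  assumes f: "L2_on s T f" and P: "\<And>m. bounded_linear (P m)"
    and P_le: "\<And>m x. norm (P m x) \<le> K * norm x" and K: "K \<ge> 0"
    and lim: "\<And>x. (\<lambda>m. P m x) \<longlonglongrightarrow> x"
  shows "integrable (lebesgue_on {s..T}) (\<lambda>t. (norm (f t - P m (f t)))\<^sup>2)"
    and "(\<lambda>m. LINT t|lebesgue_on {s..T}. (norm (f t - P m (f t)))\<^sup>2) \<longlonglongrightarrow> 0"
proof -
  let ?M = "lebesgue_on {s..T}"
  let ?w = "\<lambda>t. (1 + K)\<^sup>2 * (norm (f t))\<^sup>2"
  have [measurable]: "f \<in> borel_measurable ?M"
    using f by (simp add: L2_on_def)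
  have [measurable]: "P m \<in> borel_measurable borel" for m
    using linear_continuous_on[OF P] by (rule borel_measurable_continuous_onI)
  have w: "integrable ?M ?w"
    using f by (auto simp: L2_on_def)
  have bound: "(norm (f t - P m (f t)))\<^sup>2 \<le> ?w t" for m t
  proof -
    have "norm (f t - P m (f t)) \<le> (1 + K) * norm (f t)"
      using norm_triangle_ineq4[of "f t" "P m (f t)"] P_le[of m "f t"] by (simp add: algebra_simps)
    then show ?thesis
      unfolding power_mult_distrib[symmetric] by (intro power_mono) auto
  qed
  have meas: "(\<lambda>t. (norm (f t - P m (f t)))\<^sup>2) \<in> borel_measurable ?M" for m
    by measurable
  show "integrable ?M (\<lambda>t. (norm (f t - P m (f t)))\<^sup>2)"
    using bound by (intro Bochner_Integration.integrable_bound[OF w meas] AE_I2)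
      (auto intro: order_trans abs_ge_self)
  have "(\<lambda>m. (norm (f t - P m (f t)))\<^sup>2) \<longlonglongrightarrow> (norm (f t - f t))\<^sup>2" for t
    by (intro tendsto_intros lim)
  then have "(\<lambda>m. LINT t|?M. (norm (f t - P m (f t)))\<^sup>2) \<longlonglongrightarrow> (LINT t|?M. 0)"
    using bound by (intro integral_dominated_convergence[where w = ?w] w meas AE_I2) auto
  then show "(\<lambda>m. LINT t|?M. (norm (f t - P m (f t)))\<^sup>2) \<longlonglongrightarrow> 0" by simp
qed

section \<open>Convergence of the approximating evolution systems\<close>

theorem lemma3p4:
  fixes \<iota> :: "'v::{complex_hilbert_space, second_countable_topology} \<Rightarrow>
               'h::{complex_hilbert_space, second_countable_topology}"
    and a :: "real \<Rightarrow> 'v \<Rightarrow> 'v \<Rightarrow> complex"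
    and T M \<alpha> :: real
    and \<omega> :: "real \<Rightarrow> real"
    and \<phi> :: "nat \<Rightarrow> 'v"
    and E :: "real \<Rightarrow> real \<Rightarrow> 'h \<Rightarrow> 'h"
    and Em :: "nat \<Rightarrow> real \<Rightarrow> real \<Rightarrow> 'h \<Rightarrow> 'h"
  assumes embedding: "dense_embedding \<iota>"
    and T_pos: "T > 0"
    and form: "\<And>t. t \<in> {0..T} \<Longrightarrow> sesquilinear (a t)"
    and H1: "\<And>u v. (\<lambda>t. a t u v) \<in> borel_measurable (lebesgue_on {0..T})"
    and H2_pos: "M > 0"
    and H2: "\<And>t u v. t \<in> {0..T} \<Longrightarrow> norm (a t u v) \<le> M * norm u * norm v"
    and H3_pos: "\<alpha> > 0"
    and H3: "\<And>t u. t \<in> {0..T} \<Longrightarrow> Re (a t u u) \<ge> \<alpha> * (norm u)\<^sup>2"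
    and H4: "\<And>t s u v. t \<in> {0..T} \<Longrightarrow> s \<in> {0..T} \<Longrightarrow>
               norm (a t u v - a s u v) \<le> \<omega> \<bar>t - s\<bar> * norm u * norm v"
    and \<omega>_nonneg: "\<And>t. t \<in> {0..T} \<Longrightarrow> \<omega> t \<ge> 0"
    and \<omega>_mono: "mono_on {0..T} \<omega>"
    and \<omega>_int1: "integrable (lebesgue_on {0..T}) (\<lambda>t. \<omega> t * t powr (-3/2))"
    and \<omega>_int2: "integrable (lebesgue_on {0..T}) (\<lambda>t. (\<omega> t / t)\<^sup>2)"
    and S: "\<And>t. t \<in> {0..T} \<Longrightarrow> Domain (sqrt_op (assoc_op \<iota> (a t))) = range \<iota>"
    and basis_V: "schauder_basis \<phi>"
    and basis_H: "schauder_basis (\<lambda>n. \<iota> (\<phi> n))"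
    and orthogonal: "\<And>i j. i \<noteq> j \<Longrightarrow> cinner (\<iota> (\<phi> i)) (\<iota> (\<phi> j)) = 0"
    and E: "evolution_system \<iota> T (\<lambda>t. assoc_op \<iota> (a t)) E"
    and Em: "\<And>m. m \<ge> 1 \<Longrightarrow>
               evolution_system \<iota> T (\<lambda>t. assoc_op \<iota> (approx_form a \<alpha> \<phi> m t)) (Em m)"
  shows "\<forall>x. \<forall>s\<in>{0..<T}.
           uniform_limit {s<..T}
             (\<lambda>m t. Em m t s (basis_proj (\<lambda>n. \<iota> (\<phi> n)) m x)) (\<lambda>t. E t s x) sequentially"
proof -
  let ?e = "\<lambda>n. \<iota> (\<phi> n)"
  let ?P = "basis_proj \<phi>"
  let ?Q = "basis_proj ?e"
  have \<iota>: "bounded_clinear \<iota>" "inj \<iota>" "closure (range \<iota>) = UNIV"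
    using embedding by (auto simp: dense_embedding_def)
  then have bl_\<iota>: "bounded_linear \<iota>" by (simp add: bounded_clinear_def)
  note bl_P = bounded_linear_basis_proj[OF \<iota>(1) basis_V basis_H orthogonal]
  note bl_Q = bounded_linear_basis_proj_orthogonal[OF basis_H orthogonal]
  note PQ = basis_proj_embedding[OF \<iota>(1) basis_V basis_H orthogonal]
  obtain c where c: "c \<ge> 0" "\<And>v. norm (\<iota> v) \<le> c * norm v"
    using bounded_linear.nonneg_bounded[OF bl_\<iota>] by (auto simp: mult.commute)
  obtain K where K: "K \<ge> 0" "\<And>m v. norm (?P m v) \<le> K * norm v"
  proof (rule uniform_boundedness)
    show "bounded_linear (?P m)" for m by (rule bl_P)
    show "bounded (range (\<lambda>m. ?P m v))" for v
      using basis_proj_tendsto[OF basis_V] by (rule convergent_imp_bounded)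
  qed blast
  define C1 C2 where "C1 = M\<^sup>2 / \<alpha> + \<alpha>" and "C2 = 2 * c\<^sup>2 / \<alpha>"
  have C: "C1 \<ge> 0" "C2 \<ge> 0"
    using H3_pos by (auto simp: C1_def C2_def)
  \<comment> \<open>Initial values from \<open>V\<close> come first:
    \<open>?Q m (\<iota> x) = \<iota> (?P m x)\<close> lies in the range of \<iota>, so both
    evolutions are given by solutions of their Cauchy problems.\<close>
  have conv_V: "uniform_limit {s<..T} (\<lambda>m t. Em m t s (?Q m (\<iota> x))) (\<lambda>t. E t s (\<iota> x)) sequentially"
    if s: "s \<in> {0..<T}" for s x
  proof -
    let ?L = "lebesgue_on {s..T}"
    let ?u = "\<lambda>t. evol_ext E t s (\<iota> x)"
    let ?um = "\<lambda>m t. evol_ext (Em m) t s (\<iota> (?P m x))"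
    have "solves_cauchy \<iota> (\<lambda>t. assoc_op \<iota> (a t)) s T (\<iota> x) ?u"
      using E s unfolding evolution_system_def by auto
    then obtain w g where w: "L2_on s T w" and g: "L2_on s T g" and u: "continuous_on {s..T} ?u" "?u s = \<iota> x"
      and u_FTC: "\<And>r t. s < r \<Longrightarrow> r \<le> t \<Longrightarrow> t < T \<Longrightarrow>
        ?u t - ?u r = (LINT \<tau>|?L. indicator {r<..t} \<tau> *\<^sub>R g \<tau>)"
      and u_eq: "AE t in ?L. ?u t = \<iota> (w t) \<and> (\<forall>v. a t (w t) v = cinner (- g t) (\<iota> v))"
      by (rule solves_cauchy_assoc_opE[OF \<iota>(2)]) (rule that)
    define G where "G m t = C1 * (norm (w t - ?P m (w t)))\<^sup>2 + C2 * (norm (g t - ?Q m (g t)))\<^sup>2" for m t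
    have Q_le: "norm (?Q m y) \<le> 1 * norm y" for m y
      using norm_basis_proj_le[OF basis_H orthogonal] by simp
    note err_w = integral_projection_error_tendsto_0[OF w bl_P K(2,1) basis_proj_tendsto[OF basis_V]]
    note err_g = integral_projection_error_tendsto_0[OF g bl_Q Q_le zero_le_one basis_proj_tendsto[OF basis_H]]
    have G_int: "integrable ?L (G m)" for m
      unfolding G_def by (intro Bochner_Integration.integrable_add integrable_mult_right err_w err_g)
    have G_eq: "(LINT t|?L. G m t) = C1 * (LINT t|?L. (norm (w t - ?P m (w t)))\<^sup>2)
        + C2 * (LINT t|?L. (norm (g t - ?Q m (g t)))\<^sup>2)" for m
      unfolding G_def by (simp add: Bochner_Integration.integral_add err_w(1) err_g(1))
    \<comment> \<open>The error of the initial values plus the integrated consistency error; it does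
      not depend on the time, whence the uniformity.\<close>
    define R where "R m = (norm (\<iota> (?P m x) - \<iota> x))\<^sup>2 + (LINT t|?L. G m t)" for m
    have "R \<longlonglongrightarrow> (norm (\<iota> x - \<iota> x))\<^sup>2 + (C1 * 0 + C2 * 0)"
      unfolding R_def G_eq
      by (intro tendsto_intros bounded_linear.tendsto[OF bl_\<iota>] basis_proj_tendsto[OF basis_V]
          err_w(2) err_g(2))
    then have R: "R \<longlonglongrightarrow> 0" by simp
    have bound: "(norm (?um m t - ?u t))\<^sup>2 \<le> R m" if m: "m \<ge> 1" and t: "t \<in> {s..T}" for m t
    proof -
      have "solves_cauchy \<iota> (\<lambda>t. assoc_op \<iota> (approx_form a \<alpha> \<phi> m t)) s T (\<iota> (?P m x)) (?um m)"
        using Em[OF m] s unfolding evolution_system_def by auto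
      then obtain w' g' where w': "L2_on s T w'" and g': "L2_on s T g'"
        and um: "continuous_on {s..T} (?um m)" "?um m s = \<iota> (?P m x)"
        and um_FTC: "\<And>r t. s < r \<Longrightarrow> r \<le> t \<Longrightarrow> t < T \<Longrightarrow>
          ?um m t - ?um m r = (LINT \<tau>|?L. indicator {r<..t} \<tau> *\<^sub>R g' \<tau>)"
        and um_eq: "AE t in ?L. ?um m t = \<iota> (w' t)
          \<and> (\<forall>v. approx_form a \<alpha> \<phi> m t (w' t) v = cinner (- g' t) (\<iota> v))"
        by (rule solves_cauchy_assoc_opE[OF \<iota>(2)]) (rule that)
      note int_g = L2_on_imp_integrable[OF g] and int_g' = L2_on_imp_integrable[OF g']
      have "(norm (?um m t - ?u t))\<^sup>2 \<le> (norm (?um m s - ?u s))\<^sup>2 + (LINT t|?L. G m t)"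
      proof (rule energy_inequality[where g = "\<lambda>t. g' t - g t" and e = "\<lambda>t. ?um m t - ?u t"])
        show "continuous_on {s..T} (\<lambda>t. ?um m t - ?u t)"
          by (intro continuous_on_diff um u)
        show "integrable ?L (\<lambda>t. g' t - g t)"
          by (intro Bochner_Integration.integrable_diff int_g int_g')
        show "?um m q - ?u q - (?um m p - ?u p)
            = (LINT \<tau>|?L. indicator {p<..q} \<tau> *\<^sub>R (g' \<tau> - g \<tau>))" if "s < p" "p \<le> q" "q < T" for p q
          unfolding scaleR_diff_right Bochner_Integration.integral_diff[OF
              integrable_indicator_lebesgue_on[OF int_g'] integrable_indicator_lebesgue_on[OF int_g]]
            u_FTC[OF that, symmetric] um_FTC[OF that, symmetric]
          by simp
        show "AE t in ?L. 2 * inner (g' t - g t) (?um m t - ?u t) \<le> G m t"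
          \<comment> \<open>\<open>AE_space\<close> supplies \<open>t \<in> {s..T}\<close>, where
            the hypotheses on the form hold.\<close>
          using u_eq um_eq AE_space
        proof eventually_elim
          case (elim t)
          then have t: "t \<in> {0..T}" using s by auto
          have "2 * inner (g' t - g t) (\<iota> (w' t) - \<iota> (w t)) \<le> G m t"
            unfolding G_def C1_def C2_def
          proof (rule form_energy_estimate)
            show "sesquilinear (a t)" by (rule form[OF t])
            show "norm (a t y z) \<le> M * norm y * norm z" for y z by (rule H2[OF t])
            show "\<alpha> * (norm y)\<^sup>2 \<le> Re (a t y y)" for y by (rule H3[OF t])
            show "cinner (?Q m y) z = cinner y (?Q m z)" for y z
              by (rule cinner_basis_proj[OF basis_H orthogonal])
            show "a t (?P m (w' t)) (?P m v) + complex_of_real \<alpha> * cinner (w' t - ?P m (w' t)) (v - ?P m v)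
                = cinner (- g' t) (\<iota> v)" for v
              using elim by (simp add: approx_form_def)
          qed (use elim c PQ H3_pos bl_\<iota> bl_P in \<open>auto simp: bounded_linear.linear\<close>)
          then show ?case using elim by simp
        qed
        show "G m t \<ge> 0" for t
          using C by (simp add: G_def)
      qed (use G_int s t in auto)
      then show ?thesis by (simp add: R_def u um)
    qed
    show ?thesis
    proof (rule uniform_limitI)
      fix \<epsilon> :: real assume \<epsilon>: "\<epsilon> > 0"
      then have "\<forall>\<^sub>F m in sequentially. R m < \<epsilon>\<^sup>2"
        using R by (intro order_tendstoD) auto
      then show "\<forall>\<^sub>F m in sequentially. \<forall>t\<in>{s<..T}. dist (Em m t s (?Q m (\<iota> x))) (E t s (\<iota> x)) < \<epsilon>"
        using eventually_ge_at_top[of 1]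
      proof eventually_elim
        case (elim m)
        show ?case
        proof
          fix t assume t: "t \<in> {s<..T}"
          then have "(norm (?um m t - ?u t))\<^sup>2 < \<epsilon>\<^sup>2"
            using bound[of m t] elim by auto
          then have "norm (?um m t - ?u t) < \<epsilon>"
            using \<epsilon> by (simp add: power_less_imp_less_base)
          then show "dist (Em m t s (?Q m (\<iota> x))) (E t s (\<iota> x)) < \<epsilon>"
            using t by (simp add: evol_ext_def dist_norm PQ)
        qed
      qed
    qed
  qed
  have contraction: "dist (F t s y) (F t s z) \<le> dist y z"
    if "evolution_system \<iota> T A F" "0 \<le> s" "s < t" "t \<le> T" for F A s t y z
  proof -
    have "linear (F t s)" and "norm (F t s (y - z)) \<le> norm (y - z)"
      using that by (auto simp: evolution_system_def bounded_clinear_def bounded_linear.linear)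
    then show ?thesis by (simp add: dist_norm linear_diff)
  qed
  show ?thesis
  proof (intro allI ballI uniform_limitI)
    fix x s and \<epsilon> :: real
    assume s: "s \<in> {0..<T}" and \<epsilon>: "\<epsilon> > 0"
    have "x \<in> closure (range \<iota>)" using \<iota> by simp
    then obtain y where y: "dist (\<iota> y) x < \<epsilon> / 3"
      using \<epsilon> unfolding closure_approachable by (metis divide_pos_pos rangeE zero_less_numeral)
    have "\<forall>\<^sub>F m in sequentially. \<forall>t\<in>{s<..T}. dist (Em m t s (?Q m (\<iota> y))) (E t s (\<iota> y)) < \<epsilon> / 3"
      using \<epsilon> by (intro uniform_limitD[OF conv_V[OF s]]) simp
    then show "\<forall>\<^sub>F m in sequentially. \<forall>t\<in>{s<..T}. dist (Em m t s (?Q m x)) (E t s x) < \<epsilon>"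
      using eventually_ge_at_top[of 1]
    proof eventually_elim
      case (elim m)
      show ?case
      proof
        fix t assume t: "t \<in> {s<..T}"
        \<comment> \<open>The evolution operators and \<open>?Q m\<close> are contractions on
          \<open>H\<close>, so the cost of replacing \<open>x\<close> by \<open>\<iota> y\<close>
          depends neither on \<open>m\<close> nor on \<open>t\<close>.\<close>
        have "dist (Em m t s (?Q m x)) (Em m t s (?Q m (\<iota> y))) \<le> dist (?Q m x) (?Q m (\<iota> y))"
          using elim s t by (intro contraction[OF Em]) auto
        also have "\<dots> \<le> dist x (\<iota> y)"
          using norm_basis_proj_le[OF basis_H orthogonal, of m "x - \<iota> y"]
          by (simp add: dist_norm linear_diff bounded_linear.linear[OF bl_Q])
        finally have "dist (Em m t s (?Q m x)) (Em m t s (?Q m (\<iota> y))) < \<epsilon> / 3"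
          using y by (simp add: dist_commute)
        moreover have "dist (E t s (\<iota> y)) (E t s x) < \<epsilon> / 3"
          using contraction[OF E, of s t "\<iota> y" x] s t y by simp
        moreover have "dist (Em m t s (?Q m (\<iota> y))) (E t s (\<iota> y)) < \<epsilon> / 3"
          using elim t by blast
        ultimately show "dist (Em m t s (?Q m x)) (E t s x) < \<epsilon>"
          using dist_triangle[of "Em m t s (?Q m x)" "E t s x" "Em m t s (?Q m (\<iota> y))"]
            dist_triangle[of "Em m t s (?Q m (\<iota> y))" "E t s x" "E t s (\<iota> y)"] by simp
      qed
    qed
  qed
qed

end
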